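(* Let $q = p^r$, where $p$ is prime and $r$ is a positive integer, and let $k$ be an integer with $2 \leq k \leq q$. Suppose that either $q$ is odd, or $q$ is even and $k \notin \{3, q-1\}$. Consider the following statements (1)-(5) about the fixed pair $(k,q)$. (1) The maximum width $n$ of a $k \times n$ MDS code with entries in $\mathbb{F}_q$ is $q+1$, unless $q$ is even and $k \in \{3,q-1\}$, in which case the maximum width is $q+2$. (2) For every $k \times (q+2)$ matrix $M'$ with entries in $\mathbb{F}_q$, some nontrivial $\mathbb{F}_q$-linear combination of the rows of $M'$ has at least $k$ zero entries. (3) For every $k \times (q+2)$ matrix $M'$ with entries in $\mathbb{F}_q$ whose first two columns are $[1,0,\ldots,0]^{\top}$ and $[0,1,0,\ldots,0]^{\top}$, some nontrivial $\mathbb{F}_q$-linear combination of the rows of $M'$ has at least $k$ zero entries. (4) There do not exist distinct $\mathbb{F}_q$-linear subspaces $Y$ and $Z$ of $\mathcal{P}_q$ such that all of the following hold: (a) $\dim(\langle Y, Z \rangle) = k$; (b) $\dim(Y) = \dim(Z) = k-1$; (c) $\langle Y, Z \rangle \subseteq \mathcal{O}_{k-1}$; (d) $Y \cup Z \subseteq \mathcal{O}_{k-2}$; (e) $Y \cap Z \subseteq \mathcal{O}_{k-3}$. (5) There is no integer $s$ with $k < s \leq q$ such that $s-k+2$ columns $\mathcal{B} = \{b_1,\ldots,b_{s-k+2}\}$, with $b_i \in \mathbb{F}_q^s$, can be added to the Reed-Solomon code $\mathcal{R}$ of dimension $s$ with entries in $\mathbb{F}_q$ in such a way that both of the following hold: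 (a) every $s \times s$ submatrix of $\mathcal{R} \cup \mathcal{B}$ (the $s \times (q+s-k+2)$ matrix whose columns are those of $\mathcal{R}$ together with $b_1,\ldots,b_{s-k+2}$) that contains the first $s-k$ columns $b_1,\ldots,b_{s-k}$ of $\mathcal{B}$ has non-zero determinant; (b) the $s-k+3$ columns $b_1,\ldots,b_{s-k+2},[0,0,\ldots,0,1]^{\top}$ are linearly independent over $\mathbb{F}_q$. Then: (Part A) statements (1), (2), (3) and (5) are equivalent; (Part B) statement (3) implies statement (4).
   Context: $\mathbb{F}_q$ is the finite field with $q$ elements. All matrices have entries in $\mathbb{F}_q$. A $k \times n$ maximum distance separable (MDS) code is a $k \times n$ matrix with entries in $\mathbb{F}_q$ such that every set of $k$ columns is linearly independent; $n$ is its width. A nontrivial linear combination of the rows of a $k \times n$ matrix $M$ is a row vector $\vec{L}M$ with $\vec{L} \in \mathbb{F}_q^k \setminus \{\vec{0}\}$ (that is, the coefficients are not all zero). $\mathcal{P}_q$ denotes the ring $\mathbb{F}_q[x]/(x^q-x)$ of polynomial functions over $\mathbb{F}_q$, viewed as a vector space over $\mathbb{F}_q$. For an integer $n$, $\mathcal{O}_n \subseteq \mathcal{P}_q$ is the set of elements of $\mathcal{P}_q$ that are either zero or have at most $n$ distinct roots in $\mathbb{F}_q$; in particular $\mathcal{O}_n = \mathcal{P}_q$ if $n \geq q$, and $\mathcal{O}_{-1} = \{0\}$. For subspaces $Y, Z$ of $\mathcal{P}_q$, $\langle Y, Z \rangle$ denotes the subspace of $\mathcal{P}_q$ generated by the elements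 of $Y$ and $Z$. The Reed-Solomon code of dimension $s$ with entries in $\mathbb{F}_q$ is the $s \times q$ matrix whose columns are the vectors $[1,a,a^2,\ldots,a^{s-1}]^{\top}$, one for each $a \in \mathbb{F}_q$ (with $a^0=1$ for all $a$). *)

theory Defs
  imports
    "Jordan_Normal_Form.DL_Rank_Submatrix"
    "HOL-Computational_Algebra.Polynomial"
    "HOL-Computational_Algebra.Primes"
    "HOL-Library.Cardinality"
    "HOL-Library.Countable_Set"
begin

text \<open>The finite field with \<open>q\<close> elements is a type \<open>'a :: {field,finite}\<close> with
  \<open>CARD('a) = q\<close>; matrices and vectors are those of \<^theory>\<open>Jordan_Normal_Form.Matrix\<close>,
  with indices starting at 0.\<close>

section \<open>MDS codes\<close>

text \<open>Linear independence of a family: the predicate of the library is about sets of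
  vectors, so repetitions have to be excluded separately.\<close>

definition lin_indpt_list :: "nat \<Rightarrow> 'a :: field vec list \<Rightarrow> bool" where
  "lin_indpt_list d vs \<longleftrightarrow>
     set vs \<subseteq> carrier_vec d \<and> distinct vs \<and>
     \<not> LinearCombinations.module.lin_dep class_ring (module_vec TYPE('a) d) (set vs)"

definition mds_code :: "nat \<Rightarrow> nat \<Rightarrow> 'a :: field mat \<Rightarrow> bool" where
  "mds_code k n M \<longleftrightarrow>
     M \<in> carrier_mat k n \<and>
     (\<forall>J. J \<subseteq> {..<n} \<and> card J = k \<longrightarrow> lin_indpt_list k (cols (submatrix M UNIV J)))"

definition is_max_mds_width :: "'a :: field itself \<Rightarrow> nat \<Rightarrow> nat \<Rightarrow> bool" where
  "is_max_mds_width _ k N \<longleftrightarrow>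
     (\<exists>M :: 'a mat. mds_code k N M) \<and>
     (\<forall>n. (\<exists>M :: 'a mat. mds_code k n M) \<longrightarrow> n \<le> N)"

definition mds_width_stmt :: "'a :: {field,finite} itself \<Rightarrow> nat \<Rightarrow> bool" where
  "mds_width_stmt F k \<longleftrightarrow>
     is_max_mds_width F k
       (if even CARD('a) \<and> k \<in> {3, CARD('a) - 1} then CARD('a) + 2 else CARD('a) + 1)"


section \<open>Zeros in linear combinations of rows\<close>

text \<open>The row vector \<open>L M\<close> is the vector \<open>M\<^sup>T *\<^sub>v L\<close>.\<close>

definition has_row_comb_with_zeros :: "nat \<Rightarrow> 'a :: field mat \<Rightarrow> bool" where
  "has_row_comb_with_zeros m M \<longleftrightarrow>
     (\<exists>L \<in> carrier_vec (dim_row M). L \<noteq> 0\<^sub>v (dim_row M) \<and>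
        card {j. j < dim_col M \<and> (M\<^sup>T *\<^sub>v L) $ j = 0} \<ge> m)"

definition row_zeros_stmt :: "'a :: {field,finite} itself \<Rightarrow> nat \<Rightarrow> bool" where
  "row_zeros_stmt _ k \<longleftrightarrow>
     (\<forall>M' :: 'a mat. M' \<in> carrier_mat k (CARD('a) + 2) \<longrightarrow> has_row_comb_with_zeros k M')"

definition row_zeros_normalized_stmt :: "'a :: {field,finite} itself \<Rightarrow> nat \<Rightarrow> bool" where
  "row_zeros_normalized_stmt _ k \<longleftrightarrow>
     (\<forall>M' :: 'a mat. M' \<in> carrier_mat k (CARD('a) + 2) \<and>
        col M' 0 = unit_vec k 0 \<and> col M' 1 = unit_vec k 1 \<longrightarrow> has_row_comb_with_zeros k M')"


section \<open>The ring of polynomial functions\<close>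

definition frob_poly :: "'a :: {field,finite} poly" where
  "frob_poly = Polynomial.monom 1 CARD('a) - Polynomial.monom 1 1"

lemma finite_field_power_CARD: "(x :: 'a :: {field,finite}) ^ CARD('a) = x"
proof (cases "x = 0")
  case True
  then show ?thesis by (simp add: zero_power)
next
  case False
  let ?U = "UNIV - {0 :: 'a}"
  have "bij_betw ((*) x) ?U ?U"
    by (rule bij_betwI[where g = "\<lambda>y. y / x"]) (use False in auto)
  then have "(\<Prod>y\<in>?U. y) = (\<Prod>y\<in>?U. x * y)"
    by (rule prod.reindex_bij_betw[symmetric])
  also have "\<dots> = x ^ card ?U * (\<Prod>y\<in>?U. y)"
    by (simp add: prod.distrib)
  finally have "x ^ card ?U * (\<Prod>y\<in>?U. y) = 1 * (\<Prod>y\<in>?U. y)"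
    by (simp only: mult_1_left)
  moreover have "(\<Prod>y\<in>?U. y) \<noteq> 0"
    by (subst prod_zero_iff) auto
  ultimately have pow: "x ^ card ?U = 1"
    by (simp only: mult_cancel_right) blast
  have "CARD('a) = Suc (card ?U)"
    by (rule card.remove) simp_all
  then have "x ^ CARD('a) = x * x ^ card ?U"
    by (simp only: power_Suc)
  then show ?thesis
    by (simp only: pow mult_1_right)
qed

lemma poly_frob_poly [simp]: "poly frob_poly x = 0"
  by (simp add: frob_poly_def poly_monom finite_field_power_CARD)

text \<open>\<open>'a polfun\<close> is the quotient ring of \<open>'a poly\<close> by the ideal generated by
  \<open>x\<^sup>q - x\<close>.\<close>

quotient_type (overloaded) 'a polfun =
  "'a :: {field,finite} poly" / "\<lambda>f g. frob_poly dvd (f - g)"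
proof (rule equivpI)
  show "reflp (\<lambda>f g :: 'a poly. frob_poly dvd (f - g))"
    by (rule reflpI) simp
  show "symp (\<lambda>f g :: 'a poly. frob_poly dvd (f - g))"
    by (rule sympI) (metis dvd_minus_iff minus_diff_eq)
  show "transp (\<lambda>f g :: 'a poly. frob_poly dvd (f - g))"
  proof (rule transpI)
    fix f g h :: "'a poly"
    assume "frob_poly dvd f - g" "frob_poly dvd g - h"
    then have "frob_poly dvd (f - g) + (g - h)" by (rule dvd_add)
    then show "frob_poly dvd f - h" by simp
  qed
qed

instantiation polfun :: ("{field,finite}") comm_ring_1
begin

lift_definition zero_polfun :: "'a polfun" is 0 .
lift_definition one_polfun :: "'a polfun" is 1 .

lift_definition plus_polfun :: "'a polfun \<Rightarrow> 'a polfun \<Rightarrow> 'a polfun" is "(+)"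
proof -
  fix f f' g g' :: "'a poly"
  assume "frob_poly dvd f - f'" "frob_poly dvd g - g'"
  then have "frob_poly dvd (f - f') + (g - g')" by (rule dvd_add)
  then show "frob_poly dvd f + g - (f' + g')" by (simp add: algebra_simps)
qed

lift_definition uminus_polfun :: "'a polfun \<Rightarrow> 'a polfun" is uminus
  by (metis dvd_minus_iff minus_diff_eq minus_diff_minus)

lift_definition minus_polfun :: "'a polfun \<Rightarrow> 'a polfun \<Rightarrow> 'a polfun" is "(-)"
proof -
  fix f f' g g' :: "'a poly"
  assume "frob_poly dvd f - f'" "frob_poly dvd g - g'"
  then have "frob_poly dvd (f - f') - (g - g')" by (rule dvd_diff)
  then show "frob_poly dvd f - g - (f' - g')" by (simp add: algebra_simps)
qed

lift_definition times_polfun :: "'a polfun \<Rightarrow> 'a polfun \<Rightarrow> 'a polfun" is "(*)"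
proof -
  fix f f' g g' :: "'a poly"
  assume "frob_poly dvd f - f'" "frob_poly dvd g - g'"
  then have "frob_poly dvd (f - f') * g + f' * (g - g')"
    by (intro dvd_add dvd_mult dvd_mult2)
  then show "frob_poly dvd f * g - f' * g'" by (simp add: algebra_simps)
qed

instance
proof
  show "(0 :: 'a polfun) \<noteq> 1"
  proof transfer
    show "\<not> (frob_poly :: 'a poly) dvd 0 - 1"
    proof
      assume "(frob_poly :: 'a poly) dvd 0 - 1"
      then obtain h :: "'a poly" where "0 - 1 = frob_poly * h" by (elim dvdE)
      then have "poly (0 - 1 :: 'a poly) 0 = poly (frob_poly * h) 0" by simp
      then show False by simp
    qed
  qed
qed (transfer; simp add: algebra_simps)+

end

lift_definition scale_polfun :: "'a :: {field,finite} \<Rightarrow> 'a polfun \<Rightarrow> 'a polfun" is Polynomial.smult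
  by (simp add: Polynomial.smult_diff_right [symmetric] dvd_smult)

interpretation polfun: vector_space "scale_polfun :: 'a :: {field,finite} \<Rightarrow> _"
proof
  fix a b :: 'a and f g :: "'a polfun"
  show "scale_polfun a (f + g) = scale_polfun a f + scale_polfun a g"
    by transfer (simp add: Polynomial.smult_add_right)
  show "scale_polfun (a + b) f = scale_polfun a f + scale_polfun b f"
    by transfer (simp add: Polynomial.smult_add_left)
  show "scale_polfun a (scale_polfun b f) = scale_polfun (a * b) f"
    by transfer simp
  show "scale_polfun 1 f = f"
    by transfer simp
qed

lift_definition eval_polfun :: "'a :: {field,finite} polfun \<Rightarrow> 'a \<Rightarrow> 'a" is poly
proof
  fix f g :: "'a poly" and x
  assume "frob_poly dvd f - g"
  then obtain h where "f - g = frob_poly * h" by (elim dvdE)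
  then have "poly (f - g) x = 0" by simp
  then show "poly f x = poly g x" by simp
qed

lemma eval_polfun_inject: "eval_polfun f = eval_polfun g \<longleftrightarrow> f = g"
proof
  show "f = g" if "eval_polfun f = eval_polfun g"
    using that
  proof transfer
    fix f g :: "'a poly"
    assume eq: "poly f = poly g"
    let ?h = "(f - g) mod frob_poly"
    have "CARD('a) \<noteq> 1"
      using card_mono[of UNIV "{0, 1 :: 'a}"] by simp
    then have q: "CARD('a) > 1"
      using zero_less_card_finite[where ?'a = 'a] by linarith
    have lt: "Polynomial.degree (Polynomial.monom (1 :: 'a) 1) <
              Polynomial.degree (Polynomial.monom (1 :: 'a) CARD('a))"
      using q by (simp add: Polynomial.degree_monom_eq)
    have deg: "Polynomial.degree (frob_poly :: 'a poly) = CARD('a)"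
      unfolding frob_poly_def diff_conv_add_uminus
      by (subst Polynomial.degree_add_eq_left)
        (use lt in \<open>simp_all add: Polynomial.degree_monom_eq\<close>)
    have roots: "poly ?h x = 0" for x
    proof -
      have "poly ((f - g) div frob_poly * frob_poly + ?h) x = poly (f - g) x"
        by (simp only: div_mult_mod_eq)
      then show ?thesis
        using eq by (simp only: poly_add poly_mult poly_frob_poly poly_diff) simp
    qed
    have "?h = 0"
    proof (rule ccontr)
      assume "?h \<noteq> 0"
      moreover have "(frob_poly :: 'a poly) \<noteq> 0"
        using deg q by auto
      ultimately have "Polynomial.degree ?h < CARD('a)"
        using degree_mod_less'[of frob_poly "f - g"] deg by simp
      moreover have "card {x. poly ?h x = 0} \<le> Polynomial.degree ?h"
        using \<open>?h \<noteq> 0\<close> by (rule card_poly_roots_bound)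
      ultimately show False
        by (simp add: roots)
    qed
    then show "frob_poly dvd f - g"
      by (simp add: dvd_eq_mod_eq_0)
  qed
qed simp

definition few_roots :: "int \<Rightarrow> 'a :: {field,finite} polfun set" where
  "few_roots n = {f. f = 0 \<or> int (card {a. eval_polfun f a = 0}) \<le> n}"

lemma few_roots_minus_1: "few_roots (- 1) = {0}"
  by (auto simp: few_roots_def)

lemma few_roots_UNIV: "int CARD('a) \<le> n \<Longrightarrow> few_roots n = (UNIV :: 'a :: {field,finite} polfun set)"
proof -
  assume n: "int CARD('a) \<le> n"
  have "int (card {a. eval_polfun f a = 0}) \<le> n" for f :: "'a polfun"
    using card_mono[of UNIV "{a. eval_polfun f a = 0}"] n by simp
  then show ?thesis by (auto simp: few_roots_def)
qed

definition subspaces_stmt :: "'a :: {field,finite} itself \<Rightarrow> nat \<Rightarrow> bool" where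
  "subspaces_stmt _ k \<longleftrightarrow>
     \<not> (\<exists>Y Z :: 'a polfun set.
          polfun.subspace Y \<and> polfun.subspace Z \<and> Y \<noteq> Z \<and>
          polfun.dim (polfun.span (Y \<union> Z)) = k \<and>
          polfun.dim Y = k - 1 \<and> polfun.dim Z = k - 1 \<and>
          polfun.span (Y \<union> Z) \<subseteq> few_roots (int k - 1) \<and>
          Y \<union> Z \<subseteq> few_roots (int k - 2) \<and>
          Y \<inter> Z \<subseteq> few_roots (int k - 3))"


section \<open>Extending Reed-Solomon codes\<close>

text \<open>\<open>from_nat_into UNIV\<close> enumerates the field bijectively by \<open>{..<CARD('a)}\<close>. Which
  enumeration is chosen only affects the order of the columns.\<close>

definition reed_solomon :: "nat \<Rightarrow> 'a :: {field,finite} mat" where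
  "reed_solomon s = mat s CARD('a) (\<lambda>(i, j). from_nat_into UNIV j ^ i)"

lemma bij_betw_field_enumeration:
  "bij_betw (from_nat_into (UNIV :: 'a :: {field,finite} set)) {..<CARD('a)} UNIV"
  by (rule bij_betw_from_nat_into_finite) simp

text \<open>The columns \<open>b\<^sub>1, \<dots>, b\<^sub>s\<^sub>-\<^sub>k\<^sub>+\<^sub>2\<close> form the list \<open>bs\<close>. In the matrix with columns
  \<open>cols (reed_solomon s) @ bs\<close> the columns \<open>b\<^sub>1, \<dots>, b\<^sub>s\<^sub>-\<^sub>k\<close> have the indices
  \<open>{CARD('a)..<CARD('a) + (s - k)}\<close>.\<close>

definition rs_extension_stmt :: "'a :: {field,finite} itself \<Rightarrow> nat \<Rightarrow> bool" where
  "rs_extension_stmt _ k \<longleftrightarrow>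
     \<not> (\<exists>s bs.
          k < s \<and> s \<le> CARD('a) \<and>
          length bs = s - k + 2 \<and> set bs \<subseteq> (carrier_vec s :: 'a vec set) \<and>
          (\<forall>J. {CARD('a)..<CARD('a) + (s - k)} \<subseteq> J \<and> J \<subseteq> {..<CARD('a) + (s - k + 2)} \<and>
               card J = s \<longrightarrow>
               det (submatrix (mat_of_cols s (cols (reed_solomon s) @ bs)) UNIV J) \<noteq> 0) \<and>
          lin_indpt_list s (bs @ [unit_vec s (s - 1)]))"

end

theory Submission
  imports Defs
begin

text \<open>
  A matrix with \<open>k\<close> rows has no \<open>k\<close> dependent columns iff no nontrivial combination of its
  rows has \<open>k\<close> zeros, so (1), (2) and (3) all say that there is no MDS code of width \<open>q + 2\<close>.

  If (5) fails, dividing out the span of \<open>b\<^sub>1, \<dots>, b\<^sub>s\<^sub>-\<^sub>k\<close> turns the remaining \<open>q + 2\<close>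
  columns into an MDS code in dimension \<open>k\<close>. Conversely, let \<open>[I A c d]\<close> be an MDS code of width
  \<open>q + 2\<close>, where pigeonhole arguments give \<open>2 < k < q\<close>. Take \<open>s = q\<close>. The Reed-Solomon matrix
  \<open>R\<close> is then invertible, and the columns of \<open>R [-A c d; I 0 0]\<close> extend \<open>R\<close> as in (5), provided
  that \<open>[I A] w\<close> is outside the span of \<open>c\<close> and \<open>d\<close>, where \<open>R w\<close> is the last unit vector.
  Rescaling one column of the code at a nonzero entry of \<open>w\<close> achieves this.

  For (4), the hyperplanes \<open>Y\<close> and \<open>Z\<close> of their sum are kernels of functionals. The values of a
  basis at the points of the field and under the two functionals form an MDS code of width \<open>q + 2\<close>.
\<close>

subsection \<open>Determinants and independence\<close>

text \<open>Phrases singularity through coefficient functions and finite sums, the form in which all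
  later relations between columns and combinations of rows are written.\<close>

lemma det_eq_0_iff_cols:
  fixes A :: "'a :: field mat"
  assumes A: "A \<in> carrier_mat n n"
  shows "det A = 0 \<longleftrightarrow> (\<exists>x. (\<exists>j<n. x j \<noteq> 0) \<and> (\<forall>i<n. (\<Sum>j<n. A $$ (i, j) * x j) = 0))"
  unfolding det_0_iff_vec_prod_zero_field[OF A]
proof
  assume "\<exists>v. v \<in> carrier_vec n \<and> v \<noteq> 0\<^sub>v n \<and> A *\<^sub>v v = 0\<^sub>v n"
  then obtain v where v: "v \<in> carrier_vec n" "v \<noteq> 0\<^sub>v n" "A *\<^sub>v v = 0\<^sub>v n"
    by blast
  have "\<exists>j<n. v $ j \<noteq> 0"
    using v by (metis carrier_vecD eq_vecI index_zero_vec(1) index_zero_vec(2))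
  moreover have "(\<Sum>j<n. A $$ (i, j) * v $ j) = 0" if "i < n" for i
  proof -
    have "(A *\<^sub>v v) $ i = (\<Sum>j<n. A $$ (i, j) * v $ j)"
      using A v(1) that by (auto simp: scalar_prod_def lessThan_atLeast0 intro!: sum.cong)
    then show ?thesis using v(3) that by simp
  qed
  ultimately show "\<exists>x. (\<exists>j<n. x j \<noteq> 0) \<and> (\<forall>i<n. (\<Sum>j<n. A $$ (i, j) * x j) = 0)"
    by (intro exI[of _ "($) v"]) auto
next
  assume "\<exists>x. (\<exists>j<n. x j \<noteq> 0) \<and> (\<forall>i<n. (\<Sum>j<n. A $$ (i, j) * x j) = 0)"
  then obtain x where x: "\<exists>j<n. x j \<noteq> 0" "\<forall>i<n. (\<Sum>j<n. A $$ (i, j) * x j) = 0"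
    by blast
  have "vec n x \<noteq> 0\<^sub>v n"
    using x(1) by (metis index_vec index_zero_vec(1))
  moreover have "A *\<^sub>v vec n x = 0\<^sub>v n"
  proof (rule eq_vecI)
    fix i assume "i < dim_vec (0\<^sub>v n :: 'a vec)"
    then have i: "i < n" by simp
    then have "(A *\<^sub>v vec n x) $ i = (\<Sum>j<n. A $$ (i, j) * x j)"
      using A by (auto simp: scalar_prod_def lessThan_atLeast0 intro!: sum.cong)
    then show "(A *\<^sub>v vec n x) $ i = 0\<^sub>v n $ i" using x(2) i by simp
  qed (use A in auto)
  ultimately show "\<exists>v. v \<in> carrier_vec n \<and> v \<noteq> 0\<^sub>v n \<and> A *\<^sub>v v = 0\<^sub>v n"
    by (intro exI[of _ "vec n x"]) auto
qed

lemma det_eq_0_iff_rows: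
  fixes A :: "'a :: field mat"
  assumes A: "A \<in> carrier_mat n n"
  shows "det A = 0 \<longleftrightarrow> (\<exists>c. (\<exists>i<n. c i \<noteq> 0) \<and> (\<forall>j<n. (\<Sum>i<n. c i * A $$ (i, j)) = 0))"
proof -
  have "det A = det (transpose_mat A)"
    using det_transpose[OF A] by simp
  moreover have "(\<Sum>i<n. transpose_mat A $$ (j, i) * c i) = (\<Sum>i<n. c i * A $$ (i, j))"
    if "j < n" for j c
    using A that by (intro sum.cong) (auto simp: mult.commute)
  ultimately show ?thesis
    using det_eq_0_iff_cols[of "transpose_mat A" n] A by simp
qed

lemma inverse_functions:
  fixes A :: "'a :: field mat"
  assumes A: "A \<in> carrier_mat n n" and det: "det A \<noteq> 0"
  obtains G where
    "\<forall>i<n. \<forall>j<n. (\<Sum>t<n. G i t * A $$ (t, j)) = (if i = j then 1 else 0)"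
    "\<forall>i<n. \<forall>j<n. (\<Sum>t<n. A $$ (i, t) * G t j) = (if i = j then 1 else 0)"
proof -
  obtain B where B: "B \<in> carrier_mat n n" "B * A = 1\<^sub>m n" "A * B = 1\<^sub>m n"
    using det_non_zero_imp_unit[OF A det, of "()"] by (auto simp: Units_def ring_mat_simps)
  show ?thesis
  proof (rule that[of "\<lambda>i j. B $$ (i, j)"]; intro allI impI)
    fix i j assume ij: "i < n" "j < n"
    have "(B * A) $$ (i, j) = (\<Sum>t<n. B $$ (i, t) * A $$ (t, j))"
      using A B(1) ij by (auto simp: scalar_prod_def lessThan_atLeast0 intro!: sum.cong)
    then show "(\<Sum>t<n. B $$ (i, t) * A $$ (t, j)) = (if i = j then 1 else 0)"
      using B(2) ij by simp
  next
    fix i j assume ij: "i < n" "j < n"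
    have "(A * B) $$ (i, j) = (\<Sum>t<n. A $$ (i, t) * B $$ (t, j))"
      using A B(1) ij by (auto simp: scalar_prod_def lessThan_atLeast0 intro!: sum.cong)
    then show "(\<Sum>t<n. A $$ (i, t) * B $$ (t, j)) = (if i = j then 1 else 0)"
      using B(3) ij by simp
  qed
qed

section \<open>Square blocks of columns and their determinants\<close>

text \<open>\<open>submatrix\<close> numbers the chosen columns by \<open>pick\<close>; the
  bijection turns sums over positions in the block into sums over the column set itself.\<close>

lemma bij_betw_pick:
  assumes "finite J"
  shows "bij_betw (pick J) {..<card J} J"
proof -
  have inj: "inj_on (pick J) {..<card J}"
  proof (rule linorder_inj_onI)
    show "pick J m \<noteq> pick J n" if "m < n" "n \<in> {..<card J}" for m n
      using pick_mono_le[of n J m] that by simp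
  qed auto
  have "pick J ` {..<card J} \<subseteq> J"
    using pick_in_set_le by auto
  then have "pick J ` {..<card J} = J"
    using card_image[OF inj] assms by (intro card_subset_eq) auto
  then show ?thesis using inj by (simp add: bij_betw_def)
qed

lemma submatrix_cols:
  assumes "M \<in> carrier_mat k n" and "J \<subseteq> {..<n}"
  shows "submatrix M UNIV J \<in> carrier_mat k (card J)"
    and "i < k \<Longrightarrow> t < card J \<Longrightarrow> submatrix M UNIV J $$ (i, t) = M $$ (i, pick J t)"
proof -
  have J: "{j. j < dim_col M \<and> j \<in> J} = J" and k: "card {i. i < dim_row M \<and> i \<in> UNIV} = k"
    using assms by auto
  show "submatrix M UNIV J \<in> carrier_mat k (card J)"
    by (rule carrier_matI) (simp_all only: dim_submatrix J k)
  show "submatrix M UNIV J $$ (i, t) = M $$ (i, pick J t)" if "i < k" "t < card J"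
    using submatrix_index[of i M UNIV t J] that unfolding J k pick_UNIV by simp
qed

lemma det_submatrix_eq_0_iff_rows:
  fixes M :: "'a :: field mat"
  assumes M: "M \<in> carrier_mat k n" and J: "J \<subseteq> {..<n}" "card J = k"
  shows "det (submatrix M UNIV J) = 0 \<longleftrightarrow>
    (\<exists>c. (\<exists>i<k. c i \<noteq> 0) \<and> (\<forall>j\<in>J. (\<Sum>i<k. c i * M $$ (i, j)) = 0))"
proof -
  note S = submatrix_cols[OF M J(1), unfolded J(2)]
  have "finite J" using J(1) finite_subset by blast
  then have pick: "pick J ` {..<k} = J"
    using bij_betw_pick[of J] J(2) by (simp add: bij_betw_def)
  have "(\<Sum>i<k. c i * submatrix M UNIV J $$ (i, t)) = (\<Sum>i<k. c i * M $$ (i, pick J t))"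
    if "t < k" for c t
    using that by (intro sum.cong) (auto simp: S)
  then have "(\<forall>t<k. (\<Sum>i<k. c i * submatrix M UNIV J $$ (i, t)) = 0) \<longleftrightarrow>
        (\<forall>j\<in>J. (\<Sum>i<k. c i * M $$ (i, j)) = 0)" for c
    by (subst (2) pick[symmetric]) auto
  then show ?thesis
    by (simp add: det_eq_0_iff_rows[OF S(1)])
qed

lemma det_submatrix_eq_0_iff_cols:
  fixes M :: "'a :: field mat"
  assumes M: "M \<in> carrier_mat k n" and J: "J \<subseteq> {..<n}" "card J = k"
  shows "det (submatrix M UNIV J) = 0 \<longleftrightarrow>
    (\<exists>x. (\<exists>j\<in>J. x j \<noteq> 0) \<and> (\<forall>i<k. (\<Sum>j\<in>J. M $$ (i, j) * x j) = 0))"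
proof -
  note S = submatrix_cols[OF M J(1), unfolded J(2)]
  have "finite J" using J(1) finite_subset by blast
  then have bij: "bij_betw (pick J) {..<k} J"
    using bij_betw_pick[of J] J(2) by simp
  then have pick: "pick J ` {..<k} = J" and inj: "inj_on (pick J) {..<k}"
    by (simp_all add: bij_betw_def)
  have sum: "(\<Sum>t<k. submatrix M UNIV J $$ (i, t) * y t) = (\<Sum>j\<in>J. M $$ (i, j) * x j)"
    if "i < k" "\<And>t. t < k \<Longrightarrow> y t = x (pick J t)" for x y i
  proof -
    have "(\<Sum>t<k. submatrix M UNIV J $$ (i, t) * y t) = (\<Sum>t<k. M $$ (i, pick J t) * x (pick J t))"
      using that by (intro sum.cong) (auto simp: S)
    also have "\<dots> = (\<Sum>j\<in>J. M $$ (i, j) * x j)"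
      by (rule sum.reindex_bij_betw[OF bij])
    finally show ?thesis .
  qed
  show ?thesis
    unfolding det_eq_0_iff_cols[OF S(1)]
  proof
    assume "\<exists>y. (\<exists>t<k. y t \<noteq> 0) \<and> (\<forall>i<k. (\<Sum>t<k. submatrix M UNIV J $$ (i, t) * y t) = 0)"
    then obtain y where y: "\<exists>t<k. y t \<noteq> 0"
        "\<forall>i<k. (\<Sum>t<k. submatrix M UNIV J $$ (i, t) * y t) = 0"
      by blast
    \<comment> \<open>Carries the coefficients from positions in the block back to column indices;
      only the values of \<open>x\<close> on \<open>J\<close> matter.\<close>
    define x where "x = y \<circ> the_inv_into {..<k} (pick J)"
    have x: "y t = x (pick J t)" if "t < k" for t
      using that inj by (simp add: x_def the_inv_into_f_f)
    have "\<exists>j\<in>J. x j \<noteq> 0"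
      using y(1) x pick by (metis image_eqI lessThan_iff)
    then show "\<exists>x. (\<exists>j\<in>J. x j \<noteq> 0) \<and> (\<forall>i<k. (\<Sum>j\<in>J. M $$ (i, j) * x j) = 0)"
      using y(2) sum[of _ y x] x by metis
  next
    assume "\<exists>x. (\<exists>j\<in>J. x j \<noteq> 0) \<and> (\<forall>i<k. (\<Sum>j\<in>J. M $$ (i, j) * x j) = 0)"
    then obtain x where x: "\<exists>j\<in>J. x j \<noteq> 0" "\<forall>i<k. (\<Sum>j\<in>J. M $$ (i, j) * x j) = 0"
      by blast
    have "\<exists>t<k. x (pick J t) \<noteq> 0"
      using x(1) pick by (metis imageE lessThan_iff)
    then show "\<exists>y. (\<exists>t<k. y t \<noteq> 0) \<and> (\<forall>i<k. (\<Sum>t<k. submatrix M UNIV J $$ (i, t) * y t) = 0)"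
      using x(2) sum[of _ "x \<circ> pick J" x] by (intro exI[of _ "x \<circ> pick J"]) auto
  qed
qed

section \<open>Independence, zeros and the MDS property in terms of sums\<close>

text \<open>Both sides say that the rank is full. A repeated column already lowers the rank, so a
  nonzero determinant also yields the distinctness demanded by
  \<open>lin_indpt_list\<close>.\<close>

lemma lin_indpt_list_cols_iff:
  fixes A :: "'a :: field mat"
  assumes A: "A \<in> carrier_mat n n"
  shows "lin_indpt_list n (cols A) \<longleftrightarrow> det A \<noteq> 0"
proof -
  interpret vec_space "TYPE('a)" n .
  have "set (cols A) \<subseteq> carrier_vec n"
    using cols_dim[of A] A by simp
  then show ?thesis
    using lin_indpt_full_rank[OF A] full_rank_lin_indpt[OF A] non_distinct_low_rank[OF A]
    unfolding lin_indpt_list_def det_rank_iff[OF A] by (metis less_irrefl)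
qed

lemma lin_indpt_listI:
  fixes vs :: "'a :: field vec list"
  assumes vs: "set vs \<subseteq> carrier_vec d"
    and indpt: "\<And>c i. (\<And>r. r < d \<Longrightarrow> (\<Sum>i<length vs. c i * (vs ! i) $ r) = 0) \<Longrightarrow>
      i < length vs \<Longrightarrow> c i = 0"
  shows "lin_indpt_list d vs"
proof -
  interpret vec_space "TYPE('a)" d .
  let ?A = "mat_of_cols d vs"
  have A: "?A \<in> carrier_mat d (length vs)" by simp
  have cols: "cols ?A = vs" using vs by simp
  have dist: "distinct vs"
  proof (rule ccontr)
    assume "\<not> distinct vs"
    then obtain i j where ij: "i < length vs" "j < length vs" "i \<noteq> j" "vs ! i = vs ! j"
      by (auto simp: distinct_conv_nth)
    \<comment> \<open>Equal entries at two positions satisfy the relation with coefficients 1 and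
      -1, which is nontrivial.\<close>
    define c :: "nat \<Rightarrow> 'a" where "c t = (if t = i then 1 else 0) - (if t = j then 1 else 0)" for t
    have "(\<Sum>t<length vs. c t * (vs ! t) $ r) = 0" for r
      using ij by (simp add: c_def left_diff_distrib sum_subtractf if_distrib[of "\<lambda>x. x * _"] cong: if_cong)
    then have "c i = 0" using indpt ij(1) by blast
    then show False using ij(3) by (simp add: c_def)
  qed
  have "\<not> lin_dep (set (cols ?A))"
  proof
    assume "lin_dep (set (cols ?A))"
    then obtain v where v: "v \<in> carrier_vec (length vs)" "v \<noteq> 0\<^sub>v (length vs)" "?A *\<^sub>v v = 0\<^sub>v d"
      using lin_depE[OF A] dist cols by metis
    have "(\<Sum>i<length vs. v $ i * (vs ! i) $ r) = 0" if "r < d" for r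
    proof -
      have "(?A *\<^sub>v v) $ r = (\<Sum>i<length vs. v $ i * (vs ! i) $ r)"
        using that v(1)
        by (auto simp: scalar_prod_def lessThan_atLeast0 mat_of_cols_index mult.commute intro!: sum.cong)
      then show ?thesis using v(3) that by simp
    qed
    then have "v $ i = 0" if "i < length vs" for i
      using indpt[of "($) v"] that by blast
    then show False
      using v(1,2) by (metis carrier_vecD eq_vecI index_zero_vec(1) index_zero_vec(2))
  qed
  then show ?thesis
    using vs dist cols by (simp add: lin_indpt_list_def)
qed

lemma has_row_comb_with_zeros_iff:
  assumes M: "M \<in> carrier_mat k n"
  shows "has_row_comb_with_zeros m M \<longleftrightarrow>
    (\<exists>c. (\<exists>i<k. c i \<noteq> 0) \<and> m \<le> card {j. j < n \<and> (\<Sum>i<k. c i * M $$ (i, j)) = 0})"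
proof -
  have prod: "(M\<^sup>T *\<^sub>v L) $ j = (\<Sum>i<k. c i * M $$ (i, j))"
    if "j < n" "L \<in> carrier_vec k" "\<And>i. i < k \<Longrightarrow> L $ i = c i" for L j c
    using M that by (auto simp: scalar_prod_def lessThan_atLeast0 mult.commute intro!: sum.cong)
  show ?thesis
  proof
    assume "has_row_comb_with_zeros m M"
    then obtain L where L: "L \<in> carrier_vec k" "L \<noteq> 0\<^sub>v k"
        "m \<le> card {j. j < n \<and> (M\<^sup>T *\<^sub>v L) $ j = 0}"
      using M unfolding has_row_comb_with_zeros_def by auto
    have "\<exists>i<k. L $ i \<noteq> 0"
      using L by (metis carrier_vecD eq_vecI index_zero_vec(1) index_zero_vec(2))
    moreover have "{j. j < n \<and> (M\<^sup>T *\<^sub>v L) $ j = 0} = {j. j < n \<and> (\<Sum>i<k. L $ i * M $$ (i, j)) = 0}"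
      using prod[OF _ L(1)] by auto
    ultimately show "\<exists>c. (\<exists>i<k. c i \<noteq> 0) \<and> m \<le> card {j. j < n \<and> (\<Sum>i<k. c i * M $$ (i, j)) = 0}"
      using L(3) by (intro exI[of _ "($) L"]) auto
  next
    assume "\<exists>c. (\<exists>i<k. c i \<noteq> 0) \<and> m \<le> card {j. j < n \<and> (\<Sum>i<k. c i * M $$ (i, j)) = 0}"
    then obtain c where c: "\<exists>i<k. c i \<noteq> 0" "m \<le> card {j. j < n \<and> (\<Sum>i<k. c i * M $$ (i, j)) = 0}"
      by blast
    have "vec k c \<noteq> 0\<^sub>v k" using c(1) by (metis index_vec index_zero_vec(1))
    moreover have "{j. j < n \<and> (M\<^sup>T *\<^sub>v vec k c) $ j = 0} = {j. j < n \<and> (\<Sum>i<k. c i * M $$ (i, j)) = 0}"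
      using prod[of _ "vec k c" c] by auto
    ultimately show "has_row_comb_with_zeros m M"
      using c(2) M unfolding has_row_comb_with_zeros_def by (intro bexI[of _ "vec k c"]) auto
  qed
qed

text \<open>A row vector annihilating a singular block of \<open>k\<close> columns has zeros at
  those columns; conversely, any \<open>k\<close> zeros of a combination select a singular
  block.\<close>

lemma mds_code_iff:
  fixes M :: "'a :: field mat"
  assumes M: "M \<in> carrier_mat k n"
  shows "mds_code k n M \<longleftrightarrow> \<not> has_row_comb_with_zeros k M"
proof -
  let ?Z = "\<lambda>c. {j. j < n \<and> (\<Sum>i<k. c i * M $$ (i, j)) = 0}"
  have "(\<exists>J. J \<subseteq> {..<n} \<and> card J = k \<and> det (submatrix M UNIV J) = 0) \<longleftrightarrow>
      has_row_comb_with_zeros k M"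
  proof
    assume "\<exists>J. J \<subseteq> {..<n} \<and> card J = k \<and> det (submatrix M UNIV J) = 0"
    then obtain J where J: "J \<subseteq> {..<n}" "card J = k" "det (submatrix M UNIV J) = 0"
      by blast
    then obtain c where c: "\<exists>i<k. c i \<noteq> 0" "\<forall>j\<in>J. (\<Sum>i<k. c i * M $$ (i, j)) = 0"
      using det_submatrix_eq_0_iff_rows[OF M J(1,2)] by blast
    have "card J \<le> card (?Z c)"
      using J(1) c(2) by (intro card_mono) auto
    then show "has_row_comb_with_zeros k M"
      unfolding has_row_comb_with_zeros_iff[OF M] using c(1) J(2) by blast
  next
    assume "has_row_comb_with_zeros k M"
    then obtain c where c: "\<exists>i<k. c i \<noteq> 0" "k \<le> card (?Z c)"
      unfolding has_row_comb_with_zeros_iff[OF M] by blast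
    obtain J where J: "J \<subseteq> ?Z c" "card J = k"
      by (rule obtain_subset_with_card_n[OF c(2)])
    then have J': "J \<subseteq> {..<n}" by auto
    have "det (submatrix M UNIV J) = 0"
      unfolding det_submatrix_eq_0_iff_rows[OF M J' J(2)]
      using J(1) c(1) by (intro exI[of _ c]) auto
    then show "\<exists>J. J \<subseteq> {..<n} \<and> card J = k \<and> det (submatrix M UNIV J) = 0"
      using J' J(2) by blast
  qed
  moreover have "lin_indpt_list k (cols (submatrix M UNIV J)) \<longleftrightarrow> det (submatrix M UNIV J) \<noteq> 0"
    if "J \<subseteq> {..<n}" "card J = k" for J
    using lin_indpt_list_cols_iff submatrix_cols(1)[OF M that(1)] that(2) by simp
  moreover have "mds_code k n M \<longleftrightarrow>
      (\<forall>J. J \<subseteq> {..<n} \<and> card J = k \<longrightarrow> lin_indpt_list k (cols (submatrix M UNIV J)))"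
    using M by (simp add: mds_code_def)
  ultimately show ?thesis by blast
qed

subsection \<open>Normal forms of MDS codes\<close>

lemma has_row_comb_with_zerosI:
  assumes M: "M \<in> carrier_mat k n"
    and c: "i < k" "c i \<noteq> 0"
    and S: "S \<subseteq> {..<n}" "m \<le> card S" "\<And>j. j \<in> S \<Longrightarrow> (\<Sum>i<k. c i * M $$ (i, j)) = 0"
  shows "has_row_comb_with_zeros m M"
proof -
  have "card S \<le> card {j. j < n \<and> (\<Sum>i<k. c i * M $$ (i, j)) = 0}"
    using S by (intro card_mono) auto
  then show ?thesis
    unfolding has_row_comb_with_zeros_iff[OF M] using c S(2) le_trans by blast
qed

text \<open>Any \<open>k\<close> columns of an MDS code are independent, so only the trivial
  relation can be supported on at most \<open>k\<close> columns.\<close>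

lemma relation_eq_0:
  fixes M :: "'a :: field mat"
  assumes M: "M \<in> carrier_mat k n" and mds: "\<not> has_row_comb_with_zeros k M"
    and J: "J \<subseteq> {..<n}" "card J \<le> k" "k \<le> n"
    and supp: "\<And>j. j < n \<Longrightarrow> j \<notin> J \<Longrightarrow> x j = 0"
    and rel: "\<And>i. i < k \<Longrightarrow> (\<Sum>j<n. M $$ (i, j) * x j) = 0"
    and j: "j < n"
  shows "x j = 0"
proof -
  \<comment> \<open>The support is padded to exactly \<open>k\<close> columns, so that it indexes a
    square block.\<close>
  obtain K where K: "J \<subseteq> K" "K \<subseteq> {..<n}" "card K = k"
    using exists_subset_between[of J k "{..<n}"] J by auto
  have "(\<Sum>j\<in>K. M $$ (i, j) * x j) = 0" if "i < k" for i
  proof -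
    have "(\<Sum>j\<in>K. M $$ (i, j) * x j) = (\<Sum>j<n. M $$ (i, j) * x j)"
      using K supp by (intro sum.mono_neutral_left) auto
    then show ?thesis using rel[OF that] by simp
  qed
  moreover have "det (submatrix M UNIV K) \<noteq> 0"
  proof
    assume "det (submatrix M UNIV K) = 0"
    then obtain c i where "i < k" "c i \<noteq> 0" "\<forall>j\<in>K. (\<Sum>i<k. c i * M $$ (i, j)) = 0"
      unfolding det_submatrix_eq_0_iff_rows[OF M K(2,3)] by blast
    then show False
      using mds has_row_comb_with_zerosI[OF M, of i c K k] K by simp
  qed
  ultimately have "\<forall>j\<in>K. x j = 0"
    unfolding det_submatrix_eq_0_iff_cols[OF M K(2,3)] by blast
  then show ?thesis using supp j K(1) by blast
qed

lemma identity_block_comb: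
  fixes N :: "'a :: field mat"
  assumes "\<forall>i<k. \<forall>j<k. N $$ (i, j) = (if i = j then 1 else 0)" and "j < k"
  shows "(\<Sum>i<k. c i * N $$ (i, j)) = c j"
proof -
  have "(\<Sum>i<k. c i * N $$ (i, j)) = (\<Sum>i<k. if i = j then c i else 0)"
    using assms by (intro sum.cong) auto
  then show ?thesis using assms(2) by simp
qed

text \<open>Multiply from the left by the inverse of the block of the first \<open>k\<close>
  columns. Invertible row operations change neither the zero patterns of combinations nor the
  relations between columns; the last clause records the latter, so that the absence of certain
  relations survives normalization.\<close>

lemma normalize_rows:
  fixes M :: "'a :: field mat"
  assumes M: "M \<in> carrier_mat k n" and kn: "k \<le> n" and mds: "\<not> has_row_comb_with_zeros k M"
  obtains N where "N \<in> carrier_mat k n" "\<not> has_row_comb_with_zeros k N"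
    "\<forall>i<k. \<forall>j<k. N $$ (i, j) = (if i = j then 1 else 0)"
    "\<forall>x. (\<forall>i<k. (\<Sum>j<n. N $$ (i, j) * x j) = 0) \<longrightarrow> (\<forall>i<k. (\<Sum>j<n. M $$ (i, j) * x j) = 0)"
proof -
  define A where "A = mat k k (\<lambda>(i, j). M $$ (i, j))"
  have A: "A \<in> carrier_mat k k" by (simp add: A_def)
  have A_index: "A $$ (i, j) = M $$ (i, j)" if "i < k" "j < k" for i j
    using that by (simp add: A_def)
  have det: "det A \<noteq> 0"
  proof
    assume "det A = 0"
    then obtain c i where c: "i < k" "c i \<noteq> 0" "\<forall>j<k. (\<Sum>i<k. c i * A $$ (i, j)) = 0"
      unfolding det_eq_0_iff_rows[OF A] by blast
    then show False
      using mds has_row_comb_with_zerosI[OF M, of i c "{..<k}" k] kn by (simp add: A_index)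
  qed
  obtain G where
    GA: "\<forall>i<k. \<forall>j<k. (\<Sum>t<k. G i t * A $$ (t, j)) = (if i = j then 1 else 0)" and
    AG: "\<forall>i<k. \<forall>j<k. (\<Sum>t<k. A $$ (i, t) * G t j) = (if i = j then 1 else 0)"
    by (rule inverse_functions[OF A det])
  define N where "N = mat k n (\<lambda>(i, j). \<Sum>t<k. G i t * M $$ (t, j))"
  have N: "N \<in> carrier_mat k n" by (simp add: N_def)
  have N_index: "N $$ (i, j) = (\<Sum>t<k. G i t * M $$ (t, j))" if "i < k" "j < n" for i j
    using that by (simp add: N_def)
  have comb: "(\<Sum>i<k. c i * N $$ (i, j)) = (\<Sum>t<k. (\<Sum>i<k. c i * G i t) * M $$ (t, j))"
    if "j < n" for c j
  proof -
    have "(\<Sum>i<k. c i * N $$ (i, j)) = (\<Sum>i<k. \<Sum>t<k. c i * G i t * M $$ (t, j))"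
      using that by (simp add: N_index sum_distrib_left mult.assoc)
    also have "\<dots> = (\<Sum>t<k. \<Sum>i<k. c i * G i t * M $$ (t, j))" by (rule sum.swap)
    finally show ?thesis by (simp add: sum_distrib_right)
  qed
  have unit: "N $$ (i, j) = (if i = j then 1 else 0)" if "i < k" "j < k" for i j
    using GA[rule_format, OF that] that kn by (simp add: N_index A_index)
  show ?thesis
  proof (rule that[OF N])
    show "\<not> has_row_comb_with_zeros k N"
    proof
      assume "has_row_comb_with_zeros k N"
      then obtain c i where c: "i < k" "c i \<noteq> 0"
          "k \<le> card {j. j < n \<and> (\<Sum>i<k. c i * N $$ (i, j)) = 0}"
        unfolding has_row_comb_with_zeros_iff[OF N] by blast
      \<comment> \<open>The combination can be read off at the identity block of \<open>N\<close>,
        so it cannot vanish identically when \<open>c\<close> does not.\<close>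
      have "\<exists>t<k. (\<Sum>i<k. c i * G i t) \<noteq> 0"
      proof (rule ccontr)
        assume "\<not> (\<exists>t<k. (\<Sum>i<k. c i * G i t) \<noteq> 0)"
        then have "(\<Sum>r<k. c r * N $$ (r, i)) = 0"
          using comb[of i c] c(1) kn by simp
        then show False
          using identity_block_comb[of k N i c] unit c(1,2) by simp
      qed
      moreover have "{j. j < n \<and> (\<Sum>i<k. c i * N $$ (i, j)) = 0} =
          {j. j < n \<and> (\<Sum>t<k. (\<Sum>i<k. c i * G i t) * M $$ (t, j)) = 0}"
        using comb by auto
      ultimately have "has_row_comb_with_zeros k M"
        unfolding has_row_comb_with_zeros_iff[OF M] using c(3)
        by (intro exI[of _ "\<lambda>t. \<Sum>i<k. c i * G i t"]) auto
      then show False using mds by simp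
    qed
    show "\<forall>x. (\<forall>i<k. (\<Sum>j<n. N $$ (i, j) * x j) = 0) \<longrightarrow> (\<forall>i<k. (\<Sum>j<n. M $$ (i, j) * x j) = 0)"
    proof (intro allI impI)
      fix x i assume x: "\<forall>i<k. (\<Sum>j<n. N $$ (i, j) * x j) = 0" and i: "i < k"
      \<comment> \<open>\<open>N\<close> is \<open>G\<close> times \<open>M\<close> and
        \<open>G\<close> inverts \<open>A\<close> on the right as well, so \<open>M\<close> is
        \<open>A\<close> times \<open>N\<close>.\<close>
      have M_eq: "M $$ (i, j) = (\<Sum>r<k. A $$ (i, r) * N $$ (r, j))" if "j < n" for j
      proof -
        have "(\<Sum>r<k. A $$ (i, r) * N $$ (r, j)) = (\<Sum>t<k. (\<Sum>r<k. A $$ (i, r) * G r t) * M $$ (t, j))"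
          using comb[OF that] by simp
        also have "\<dots> = (\<Sum>t<k. if t = i then M $$ (t, j) else 0)"
          using AG i by (intro sum.cong) auto
        finally show ?thesis using i by simp
      qed
      have "(\<Sum>j<n. M $$ (i, j) * x j) = (\<Sum>j<n. \<Sum>r<k. A $$ (i, r) * (N $$ (r, j) * x j))"
        by (simp add: M_eq sum_distrib_right mult.assoc)
      also have "\<dots> = (\<Sum>r<k. \<Sum>j<n. A $$ (i, r) * (N $$ (r, j) * x j))" by (rule sum.swap)
      also have "\<dots> = (\<Sum>r<k. A $$ (i, r) * (\<Sum>j<n. N $$ (r, j) * x j))"
        by (simp add: sum_distrib_left)
      finally show "(\<Sum>j<n. M $$ (i, j) * x j) = 0" using x by simp
    qed
  qed (use unit in auto)
qed

section \<open>The extreme dimensions 2 and q\<close>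

text \<open>The projective line has q + 1 points, modelled by \<open>'a option\<close> with
  \<open>None\<close> for a vanishing second coordinate (zero columns included). Two of the q + 2
  columns share a value, and one nonzero row vector annihilates both.\<close>

lemma has_row_comb_with_zeros_dim_2:
  fixes M :: "'a :: {field,finite} mat"
  assumes M: "M \<in> carrier_mat 2 (CARD('a) + 2)"
  shows "has_row_comb_with_zeros 2 M"
proof -
  let ?x = "\<lambda>j. M $$ (0, j)" and ?y = "\<lambda>j. M $$ (1, j)"
  define f where "f j = (if ?y j = 0 then None else Some (- ?x j / ?y j))" for j
  have "card (f ` {..<CARD('a) + 2}) \<le> card (UNIV :: 'a option set)"
    by (rule card_mono) auto
  also have "\<dots> < card {..<CARD('a) + 2}"
    by (simp add: card_UNIV_option)
  finally have "\<not> inj_on f {..<CARD('a) + 2}"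
    by (rule pigeonhole)
  then obtain i j where ij: "i < CARD('a) + 2" "j < CARD('a) + 2" "i \<noteq> j" "f i = f j"
    by (auto simp: inj_on_def)
  define c :: "nat \<Rightarrow> 'a" where
    "c t = (if t = 0 then (if ?y i = 0 then 0 else 1) else (if ?y i = 0 then 1 else - ?x i / ?y i))" for t
  show ?thesis
  proof (rule has_row_comb_with_zerosI[OF M, of "if ?y i = 0 then 1 else 0" c "{i, j}"])
    show "(\<Sum>t<2. c t * M $$ (t, l)) = 0" if "l \<in> {i, j}" for l
    proof -
      have "f l = f i" using that ij(4) by auto
      then show ?thesis
        by (auto simp: f_def c_def numeral_2_eq_2 field_simps split: if_splits)
    qed
  qed (use ij in \<open>auto simp: c_def\<close>)
qed

text \<open>In the normal form [I c d] all entries of \<open>c\<close> and \<open>d\<close> are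
  nonzero. The q quotients c_i / d_i take at most q - 1 values, so two rows agree in them, and a
  combination of these two rows vanishes on both last columns and on q - 2 columns of I.\<close>

lemma has_row_comb_with_zeros_dim_CARD:
  fixes M :: "'a :: {field,finite} mat"
  assumes M: "M \<in> carrier_mat (CARD('a)) (CARD('a) + 2)"
  shows "has_row_comb_with_zeros CARD('a) M"
proof (rule ccontr)
  let ?q = "CARD('a)"
  assume contra: "\<not> has_row_comb_with_zeros ?q M"
  obtain N :: "'a mat" where N: "N \<in> carrier_mat ?q (?q + 2)" and mds: "\<not> has_row_comb_with_zeros ?q N"
    and unit: "\<forall>i<?q. \<forall>j<?q. N $$ (i, j) = (if i = j then 1 else 0)"
    by (rule normalize_rows[OF M le_add1 contra]) (rule that, assumption+)
  note comb = identity_block_comb[OF unit]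
  \<comment> \<open>Otherwise row \<open>i\<close> alone has q zeros: this entry and q - 1 entries
    in the identity block.\<close>
  have nz: "N $$ (i, l) \<noteq> 0" if "i < ?q" "l = ?q \<or> l = ?q + 1" for i l
  proof
    assume 0: "N $$ (i, l) = 0"
    have "has_row_comb_with_zeros ?q N"
    proof (rule has_row_comb_with_zerosI[OF N that(1), of "\<lambda>t. if t = i then 1 else 0" "insert l ({..<?q} - {i})"])
      show "(\<Sum>t<?q. (if t = i then 1 else 0) * N $$ (t, j)) = 0" if "j \<in> insert l ({..<?q} - {i})" for j
      proof (cases "j = l")
        case True
        then show ?thesis using \<open>i < ?q\<close> 0 by (simp add: if_distrib[of "\<lambda>x. x * _"] cong: if_cong)
      next
        case False
        then show ?thesis using comb[of j "\<lambda>t. if t = i then 1 else 0"] that by auto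
      qed
      have "card (insert l ({..<?q} - {i})) = Suc (?q - 1)"
        using that by (subst card_insert_disjoint) auto
      then show "?q \<le> card (insert l ({..<?q} - {i}))" by simp
    qed (use that in auto)
    then show False using mds by simp
  qed
  let ?f = "\<lambda>i. N $$ (i, ?q) / N $$ (i, ?q + 1)"
  have "card (?f ` {..<?q}) \<le> card (UNIV - {0 :: 'a})"
    using nz by (intro card_mono) auto
  also have "\<dots> < card {..<?q}"
    by (simp add: card_Diff_singleton)
  finally have "\<not> inj_on ?f {..<?q}"
    by (rule pigeonhole)
  then obtain i j where ij: "i < ?q" "j < ?q" "i \<noteq> j" "?f i = ?f j"
    by (auto simp: inj_on_def)
  \<comment> \<open>These coefficients cancel column q; equality of the two quotients makes them
    cancel column q + 1 too.\<close>
  define c where "c t = (if t = i then N $$ (j, ?q) else 0) - (if t = j then N $$ (i, ?q) else 0)" for t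
  have two: "(\<Sum>t<?q. c t * N $$ (t, l)) = N $$ (j, ?q) * N $$ (i, l) - N $$ (i, ?q) * N $$ (j, l)" for l
    using ij(1,2)
    by (simp add: c_def left_diff_distrib sum_subtractf if_distrib[of "\<lambda>x. x * _"] cong: if_cong)
  have "has_row_comb_with_zeros ?q N"
  proof (rule has_row_comb_with_zerosI[OF N ij(1), of c "{?q, ?q + 1} \<union> ({..<?q} - {i, j})"])
    show "c i \<noteq> 0" using ij nz by (simp add: c_def)
    have "card ({..<?q} - {i, j}) = ?q - 2"
      using ij by (subst card_Diff_subset) auto
    moreover have "?q \<ge> 2" using ij by simp
    ultimately show "?q \<le> card ({?q, ?q + 1} \<union> ({..<?q} - {i, j}))"
      by (subst card_Un_disjoint) auto
    show "(\<Sum>t<?q. c t * N $$ (t, l)) = 0" if l: "l \<in> {?q, ?q + 1} \<union> ({..<?q} - {i, j})" for l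
    proof (cases "l < ?q")
      case True
      then show ?thesis using comb[OF True, of c] l by (auto simp: c_def)
    next
      case False
      then have "l = ?q \<or> l = ?q + 1" using l by auto
      then show ?thesis
        using two[of l] ij(4) nz[OF ij(1)] nz[OF ij(2)] by (auto simp: field_simps)
    qed
  qed (use ij in auto)
  then show False using mds by simp
qed

text \<open>Either \<open>M\<close> itself or \<open>M\<close> with column \<open>a\<close> scaled
  by \<open>s\<close> works. If both had a nontrivial relation whose first \<open>m\<close>
  coefficients are proportional to \<open>w\<close>, these relations could be combined into one for
  \<open>M\<close> supported on column \<open>a\<close> and the last two columns. As
  \<open>k\<close> is at least 3 it is trivial, but its coefficient at \<open>a\<close> is
  nonzero.\<close>

lemma mds_avoiding_relations:
  fixes M :: "'a :: field mat" and w :: "nat \<Rightarrow> 'a"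
  assumes M: "M \<in> carrier_mat k (m + 2)" and mds: "\<not> has_row_comb_with_zeros k M"
    and k: "3 \<le> k" "k \<le> m + 2" and a: "a < m" "w a \<noteq> 0"
    and s: "s \<noteq> 0" "s \<noteq> (1 :: 'a)"
  obtains N where "N \<in> carrier_mat k (m + 2)" "\<not> has_row_comb_with_zeros k N"
    "\<forall>x b. (\<forall>i<k. (\<Sum>j<m + 2. N $$ (i, j) * x j) = 0) \<longrightarrow> (\<forall>j<m. x j = b * w j) \<longrightarrow>
      (\<forall>j<m + 2. x j = 0)"
proof -
  define bad where "bad N x b \<longleftrightarrow> (\<forall>i<k. (\<Sum>j<m + 2. N $$ (i, j) * x j) = 0) \<and>
      (\<forall>j<m. x j = b * w j) \<and> (\<exists>j<m + 2. x j \<noteq> 0)" for N :: "'a mat" and x b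
  define N where "N = mat k (m + 2) (\<lambda>(i, j). (if j = a then s else 1) * M $$ (i, j))"
  have N: "N \<in> carrier_mat k (m + 2)" by (simp add: N_def)
  have N_index: "N $$ (i, j) = (if j = a then s else 1) * M $$ (i, j)" if "i < k" "j < m + 2" for i j
    using that by (simp add: N_def)
  have "(\<Sum>i<k. c i * N $$ (i, j)) = (if j = a then s else 1) * (\<Sum>i<k. c i * M $$ (i, j))"
    if "j < m + 2" for c j
    using that by (simp add: N_index sum_distrib_left mult_ac)
  then have zeros: "(\<Sum>i<k. c i * N $$ (i, j)) = 0 \<longleftrightarrow> (\<Sum>i<k. c i * M $$ (i, j)) = 0"
    if "j < m + 2" for c j
    using that s(1) by simp
  have mdsN: "\<not> has_row_comb_with_zeros k N"
    using mds zeros unfolding has_row_comb_with_zeros_iff[OF M] has_row_comb_with_zeros_iff[OF N]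
    by (simp cong: conj_cong)
  have False if x: "bad M x b" and y: "bad N y d" for x b y d
  proof -
    \<comment> \<open>With factor 0 the relation would live on the last two columns only.\<close>
    have b: "b \<noteq> 0"
    proof
      assume "b = 0"
      then have "x j = 0" if "j < m + 2" for j
        using x k that unfolding bad_def
        by (intro relation_eq_0[OF M mds, of "{m, m + 1}" x j]) auto
      then show False using x unfolding bad_def by blast
    qed
    have d: "d \<noteq> 0"
    proof
      assume "d = 0"
      then have "y j = 0" if "j < m + 2" for j
        using y k that unfolding bad_def
        by (intro relation_eq_0[OF N mdsN, of "{m, m + 1}" y j]) auto
      then show False using y unfolding bad_def by blast
    qed
    \<comment> \<open>Scaling \<open>y\<close> at \<open>a\<close> by \<open>s\<close> turns a
      relation of \<open>N\<close> into one of \<open>M\<close>. Cross-multiplying by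
      \<open>b\<close> and \<open>d\<close> cancels the multiples of \<open>w\<close> everywhere
      below \<open>m\<close> except at \<open>a\<close>.\<close>
    let ?z = "\<lambda>j. d * x j - b * ((if j = a then s else 1) * y j)"
    have "?z a = 0"
    proof (rule relation_eq_0[OF M mds, of "{a, m, m + 1}" ?z a])
      show "?z j = 0" if "j < m + 2" "j \<notin> {a, m, m + 1}" for j
        using x y that unfolding bad_def by auto
      show "(\<Sum>j<m + 2. M $$ (i, j) * ?z j) = 0" if i: "i < k" for i
      proof -
        have "(\<Sum>j<m + 2. M $$ (i, j) * ?z j) =
            d * (\<Sum>j<m + 2. M $$ (i, j) * x j) - b * (\<Sum>j<m + 2. N $$ (i, j) * y j)"
          unfolding sum_distrib_left sum_subtractf [symmetric]
          using i by (intro sum.cong refl) (simp add: N_index algebra_simps)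
        moreover have "(\<Sum>j<m + 2. M $$ (i, j) * x j) = 0" "(\<Sum>j<m + 2. N $$ (i, j) * y j) = 0"
          using x y i unfolding bad_def by blast+
        ultimately show ?thesis by (simp only: mult_zero_right diff_zero)
      qed
      have "card {a, m, m + 1} \<le> 3" by (simp add: card_insert_if)
      then show "card {a, m, m + 1} \<le> k" using k(1) by simp
    qed (use a k in auto)
    moreover have "?z a = d * b * w a * (1 - s)"
      using x y a unfolding bad_def by (simp add: algebra_simps)
    ultimately show False using b d a(2) s(2) by simp
  qed
  then have "(\<nexists>x b. bad M x b) \<or> (\<nexists>x b. bad N x b)" by blast
  then show ?thesis
    using that[OF M mds] that[OF N mdsN] unfolding bad_def by blast
qed

subsection \<open>Width of codes and subspaces of polynomial functions\<close>

text \<open>Extend a basis of \<open>Z\<close> to one of \<open>V\<close>. Exactly one vector is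
  added, and the functional is the coordinate at it. Linearity is claimed on \<open>V\<close> only,
  because \<open>representation\<close> gives coordinates only inside the span of the basis.\<close>

lemma (in vector_space) hyperplane_functional:
  assumes Z: "subspace Z" "Z \<subseteq> V" and V: "dim V = Suc (dim Z)"
  obtains \<phi> where
    "\<forall>I c e. (\<forall>i\<in>I. e i \<in> V) \<longrightarrow> \<phi> (\<Sum>i\<in>I. scale (c i) (e i)) = (\<Sum>i\<in>I. c i * \<phi> (e i))"
    "\<forall>v\<in>V. \<phi> v = 0 \<longrightarrow> v \<in> Z"
proof -
  obtain B where B: "B \<subseteq> Z" "independent B" "Z \<subseteq> span B" "card B = dim Z"
    by (rule basis_exists)
  have "B \<subseteq> V" using B(1) Z(2) by blast
  then obtain C where C: "B \<subseteq> C" "C \<subseteq> V" "independent C" "V \<subseteq> span C"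
    using B(2) by (rule maximal_independent_subset_extend)
  have card: "card C = Suc (card B)"
    using basis_card_eq_dim[OF C(2,4,3)] B(4) V by simp
  then have finC: "finite C"
    by (intro card_ge_0_finite) simp
  have "card (C - B) = 1"
    using card C(1) finC by (simp add: card_Diff_subset finite_subset)
  then obtain f where f: "C - B = {f}"
    by (rule card_1_singletonE)
  show ?thesis
  proof (rule that[of "\<lambda>v. representation C v f"]; intro allI ballI impI)
    fix I :: "'d set" and c e
    assume "\<forall>i\<in>I. e i \<in> V"
    then show "representation C (\<Sum>i\<in>I. scale (c i) (e i)) f = (\<Sum>i\<in>I. c i * representation C (e i) f)"
      using C(3,4) by (subst representation_sum) (auto simp: representation_scale span_scale subset_iff intro!: sum.cong)
  next
    fix v assume v: "v \<in> V" "representation C v f = 0"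
    have "v = (\<Sum>b\<in>C. scale (representation C v b) b)"
      using sum_representation_eq[OF C(3) _ finC order_refl] v(1) C(4) by auto
    also have "\<dots> = (\<Sum>b\<in>B. scale (representation C v b) b)"
      using f v(2) C(1) by (intro sum.mono_neutral_right finC) auto
    also have "\<dots> \<in> Z"
      using B(1) Z(1) by (intro subspace_sum subspace_scale) auto
    finally show "v \<in> Z" .
  qed
qed

section \<open>Reed-Solomon codes and width q + 1\<close>

lemma card_field_enumeration:
  "card {j. j < CARD('a) \<and> P (from_nat_into (UNIV :: 'a :: {field,finite} set) j)} = card {a :: 'a. P a}"
proof -
  let ?e = "from_nat_into (UNIV :: 'a set)"
  have "inj_on ?e {j. j < CARD('a) \<and> P (?e j)}"
    by (rule inj_on_subset[OF bij_betw_imp_inj_on[OF bij_betw_field_enumeration]]) auto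
  moreover have "?e ` {j. j < CARD('a) \<and> P (?e j)} = {a. P a}"
  proof (intro equalityI subsetI)
    fix a assume "a \<in> {a. P a}"
    moreover have "a \<in> ?e ` {..<CARD('a)}"
      using bij_betw_imp_surj_on[OF bij_betw_field_enumeration[where 'a = 'a]] by simp
    ultimately show "a \<in> ?e ` {j. j < CARD('a) \<and> P (?e j)}" by auto
  qed auto
  ultimately show ?thesis
    using card_image by metis
qed

lemma card_roots_less:
  fixes c :: "nat \<Rightarrow> 'a :: {field,finite}"
  assumes i: "i < n" "c i \<noteq> 0"
  shows "card {a. (\<Sum>i<n. c i * a ^ i) = 0} < n"
proof -
  define p where "p = (\<Sum>i<n. Polynomial.monom (c i) i)"
  have coeff: "Polynomial.coeff p j = (if j < n then c j else 0)" for j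
    by (simp add: p_def Polynomial.coeff_sum)
  then have "p \<noteq> 0" using i by (metis Polynomial.coeff_0)
  then have "card {a. poly p a = 0} \<le> Polynomial.degree p"
    by (rule card_poly_roots_bound)
  also have "Polynomial.degree p < n"
    using i(1) coeff by (intro Polynomial.degree_lessI) auto
  finally show ?thesis
    by (simp add: p_def poly_sum poly_monom)
qed

text \<open>A combination of rows that vanishes would be a nonzero polynomial of degree below q with
  all q field elements as roots.\<close>

lemma det_reed_solomon: "det (reed_solomon CARD('a) :: 'a :: {field,finite} mat) \<noteq> 0"
proof
  let ?R = "reed_solomon CARD('a) :: 'a mat"
  have R: "?R \<in> carrier_mat CARD('a) CARD('a)" by (simp add: reed_solomon_def)
  assume "det ?R = 0"
  then obtain c i where c: "i < CARD('a)" "c i \<noteq> 0"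
      "\<forall>j<CARD('a). (\<Sum>i<CARD('a). c i * ?R $$ (i, j)) = 0"
    unfolding det_eq_0_iff_rows[OF R] by blast
  let ?P = "\<lambda>a. (\<Sum>i<CARD('a). c i * a ^ i) = 0"
  have "{j. j < CARD('a) \<and> ?P (from_nat_into UNIV j)} = {..<CARD('a)}"
    using c(3) by (auto simp: reed_solomon_def)
  then show False
    using card_field_enumeration[of ?P] card_roots_less[of i "CARD('a)" c] c(1,2) by simp
qed

text \<open>The Reed-Solomon code extended by the point at infinity, whose column reads off the
  leading coefficient. A zero there costs one degree and hence one possible root, so a combination
  never has \<open>k\<close> zeros.\<close>

lemma ex_mds_code_Suc_CARD:
  assumes k: "0 < k" "k \<le> CARD('a :: {field,finite})"
  shows "\<exists>M :: 'a mat. mds_code k (CARD('a) + 1) M"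
proof
  let ?q = "CARD('a)"
  let ?e = "from_nat_into (UNIV :: 'a set)"
  define M where
    "M = mat k (?q + 1) (\<lambda>(i, j). if j < ?q then ?e j ^ i else if i = k - 1 then 1 else 0)"
  have M: "M \<in> carrier_mat k (?q + 1)" by (simp add: M_def)
  have "\<not> has_row_comb_with_zeros k M"
  proof
    assume "has_row_comb_with_zeros k M"
    then obtain c i where c: "i < k" "c i \<noteq> 0"
        and card: "k \<le> card {j. j < ?q + 1 \<and> (\<Sum>i<k. c i * M $$ (i, j)) = 0}" (is "k \<le> card ?Z")
      unfolding has_row_comb_with_zeros_iff[OF M] by blast
    let ?P = "\<lambda>n a. (\<Sum>i<n. c i * a ^ i) = 0"
    let ?A = "{j. j < ?q \<and> ?P k (?e j)}"
    have "(\<Sum>i<k. c i * M $$ (i, ?q)) = (\<Sum>i<k. if i = k - 1 then c i else 0)"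
      by (intro sum.cong) (auto simp: M_def)
    then have last: "(\<Sum>i<k. c i * M $$ (i, ?q)) = c (k - 1)"
      using k(1) by simp
    have sub: "?Z \<subseteq> ?A \<union> (if c (k - 1) = 0 then {?q} else {})"
    proof
      fix j assume j: "j \<in> ?Z"
      show "j \<in> ?A \<union> (if c (k - 1) = 0 then {?q} else {})"
      proof (cases "j = ?q")
        case True
        then show ?thesis using j last by simp
      next
        case False
        then have "j < ?q" using j by simp
        then have "(\<Sum>i<k. c i * M $$ (i, j)) = (\<Sum>i<k. c i * ?e j ^ i)"
          by (intro sum.cong) (auto simp: M_def)
        then show ?thesis using j \<open>j < ?q\<close> by simp
      qed
    qed
    have "card ?Z \<le> card (?A \<union> (if c (k - 1) = 0 then {?q} else {}))"
      by (rule card_mono[OF _ sub]) simp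
    also have "\<dots> \<le> card ?A + card (if c (k - 1) = 0 then {?q} else {})"
      by (rule card_Un_le)
    also have "card ?A = card {a. ?P k a}"
      by (rule card_field_enumeration)
    also have "card {a. ?P k a} + card (if c (k - 1) = 0 then {?q} else {}) < k"
    proof (cases "c (k - 1) = 0")
      case True
      obtain m where m: "k = Suc m" using k(1) by (cases k) auto
      have "i < m" using c True by (cases "i = m") (auto simp: m)
      then have "card {a. ?P m a} < m" using c(2) by (intro card_roots_less[of i])
      then show ?thesis using True by (simp add: m)
    next
      case False
      then show ?thesis using card_roots_less[of i k c] c by simp
    qed
    finally show False using card by simp
  qed
  then show "mds_code k (?q + 1) M"
    using mds_code_iff[OF M] by simp
qed

section \<open>Equivalence of statements (1), (2) and (3)\<close>

lemma mds_width_iff_row_zeros: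
  assumes k: "0 < k" "k \<le> CARD('a :: {field,finite})"
    and exc: "\<not> (even CARD('a) \<and> k \<in> {3, CARD('a) - 1})"
  shows "mds_width_stmt TYPE('a) k \<longleftrightarrow> row_zeros_stmt TYPE('a) k"
proof
  let ?q = "CARD('a)"
  assume "mds_width_stmt TYPE('a) k"
  then have max: "n \<le> ?q + 1" if "mds_code k n M" for n and M :: "'a mat"
    using that unfolding mds_width_stmt_def is_max_mds_width_def if_not_P[OF exc] by blast
  show "row_zeros_stmt TYPE('a) k"
    unfolding row_zeros_stmt_def
  proof (intro allI impI)
    fix M :: "'a mat" assume M: "M \<in> carrier_mat k (?q + 2)"
    show "has_row_comb_with_zeros k M"
      using max[of "?q + 2" M] mds_code_iff[OF M] by auto
  qed
next
  let ?q = "CARD('a)"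
  assume zeros: "row_zeros_stmt TYPE('a) k"
  have "n \<le> ?q + 1" if mds: "mds_code k n M" for n and M :: "'a mat"
  proof (rule ccontr)
    assume "\<not> n \<le> ?q + 1"
    then have n: "?q + 2 \<le> n" by simp
    have M: "M \<in> carrier_mat k n" using mds by (simp add: mds_code_def)
    \<comment> \<open>Cutting a wider code down to its first q + 2 columns reduces to the width
      treated by (2).\<close>
    define N where "N = mat k (?q + 2) (\<lambda>(i, j). M $$ (i, j))"
    have N: "N \<in> carrier_mat k (?q + 2)" by (simp add: N_def)
    then have "has_row_comb_with_zeros k N"
      using zeros by (simp add: row_zeros_stmt_def)
    then obtain c i where c: "i < k" "c i \<noteq> 0"
        "k \<le> card {j. j < ?q + 2 \<and> (\<Sum>i<k. c i * N $$ (i, j)) = 0}"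
      unfolding has_row_comb_with_zeros_iff[OF N] by blast
    have "has_row_comb_with_zeros k M"
    proof (rule has_row_comb_with_zerosI[OF M, of i c, OF c(1,2) _ c(3)])
      show "(\<Sum>i<k. c i * M $$ (i, j)) = 0"
        if "j \<in> {j. j < ?q + 2 \<and> (\<Sum>i<k. c i * N $$ (i, j)) = 0}" for j
      proof -
        have "(\<Sum>i<k. c i * N $$ (i, j)) = (\<Sum>i<k. c i * M $$ (i, j))"
          using that by (intro sum.cong) (auto simp: N_def)
        then show ?thesis using that by simp
      qed
    qed (use n in auto)
    then show False using mds mds_code_iff[OF M] by simp
  qed
  then show "mds_width_stmt TYPE('a) k"
    using ex_mds_code_Suc_CARD[OF k]
    unfolding mds_width_stmt_def is_max_mds_width_def if_not_P[OF exc] by blast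
qed

text \<open>Row reduction turns a counterexample to (2) into one to (3): its identity block contains
  the two prescribed columns since \<open>k\<close> is at least 2.\<close>

lemma row_zeros_normalized_iff:
  assumes k: "2 \<le> k" "k \<le> CARD('a :: {field,finite}) + 2"
  shows "row_zeros_normalized_stmt TYPE('a) k \<longleftrightarrow> row_zeros_stmt TYPE('a) k"
proof
  let ?q = "CARD('a)"
  assume zeros: "row_zeros_normalized_stmt TYPE('a) k"
  show "row_zeros_stmt TYPE('a) k"
    unfolding row_zeros_stmt_def
  proof (intro allI impI)
    fix M :: "'a mat" assume M: "M \<in> carrier_mat k (?q + 2)"
    show "has_row_comb_with_zeros k M"
    proof (rule ccontr)
      assume contra: "\<not> has_row_comb_with_zeros k M"
      obtain N :: "'a mat" where N: "N \<in> carrier_mat k (?q + 2)" "\<not> has_row_comb_with_zeros k N"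
          "\<forall>i<k. \<forall>j<k. N $$ (i, j) = (if i = j then 1 else 0)"
        by (rule normalize_rows[OF M k(2) contra]) (rule that, assumption+)
      have "col N j = unit_vec k j" if "j < 2" for j
        by (rule eq_vecI) (use N that k in \<open>auto simp: unit_vec_def\<close>)
      then show False
        using zeros N(1,2) by (simp add: row_zeros_normalized_stmt_def)
    qed
  qed
qed (simp add: row_zeros_stmt_def row_zeros_normalized_stmt_def)

section \<open>Subspaces of polynomial functions\<close>

lemma eval_polfun_sum:
  "eval_polfun (\<Sum>i\<in>I. scale_polfun (c i) (e i)) a = (\<Sum>i\<in>I. c i * eval_polfun (e i) a)"
proof -
  have "eval_polfun 0 a = 0" "eval_polfun (f + g) a = eval_polfun f a + eval_polfun g a"
    "eval_polfun (scale_polfun b f) a = b * eval_polfun f a" for f g b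
    by (transfer; simp)+
  then show ?thesis
    by (induction I rule: infinite_finite_induct) simp_all
qed

text \<open>A combination of rows is an element \<open>v\<close> of the sum of \<open>Y\<close> and
  \<open>Z\<close>. Each functional vanishing at \<open>v\<close> adds one zero but puts
  \<open>v\<close> into a smaller subspace, where the bound on roots drops by one. So there are
  never more than \<open>k\<close> - 1 zeros.\<close>

lemma subspaces_if_row_zeros:
  assumes zeros: "row_zeros_stmt TYPE('a :: {field,finite}) k" and k: "0 < k"
  shows "subspaces_stmt TYPE('a) k"
  unfolding subspaces_stmt_def
proof (rule notI, elim exE conjE)
  let ?q = "CARD('a)"
  let ?en = "from_nat_into (UNIV :: 'a set)"
  fix Y Z :: "'a polfun set"
  define V where "V = polfun.span (Y \<union> Z)"
  assume sub: "polfun.subspace Y" "polfun.subspace Z"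
    and "polfun.dim (polfun.span (Y \<union> Z)) = k"
    and "polfun.dim Y = k - 1" "polfun.dim Z = k - 1"
    and "polfun.span (Y \<union> Z) \<subseteq> few_roots (int k - 1)"
    and roots: "Y \<union> Z \<subseteq> few_roots (int k - 2)" "Y \<inter> Z \<subseteq> few_roots (int k - 3)"
  then have dim: "polfun.dim V = Suc (polfun.dim Y)" "polfun.dim V = Suc (polfun.dim Z)"
    and dimV: "polfun.dim V = k" and rootsV: "V \<subseteq> few_roots (int k - 1)"
    using k unfolding V_def[symmetric] by simp_all
  have YZ: "Y \<subseteq> V" "Z \<subseteq> V"
    unfolding V_def by (auto intro: polfun.span_base)
  obtain \<phi> where \<phi>:
    "\<forall>(I :: nat set) c e. (\<forall>i\<in>I. e i \<in> V) \<longrightarrow> \<phi> (\<Sum>i\<in>I. scale_polfun (c i) (e i)) = (\<Sum>i\<in>I. c i * \<phi> (e i))"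
    "\<forall>v\<in>V. \<phi> v = 0 \<longrightarrow> v \<in> Y"
    by (rule polfun.hyperplane_functional[OF sub(1) YZ(1) dim(1)])
  obtain \<psi> where \<psi>:
    "\<forall>(I :: nat set) c e. (\<forall>i\<in>I. e i \<in> V) \<longrightarrow> \<psi> (\<Sum>i\<in>I. scale_polfun (c i) (e i)) = (\<Sum>i\<in>I. c i * \<psi> (e i))"
    "\<forall>v\<in>V. \<psi> v = 0 \<longrightarrow> v \<in> Z"
    by (rule polfun.hyperplane_functional[OF sub(2) YZ(2) dim(2)])
  obtain C where C: "C \<subseteq> V" "polfun.independent C" "V \<subseteq> polfun.span C" "card C = k"
    using polfun.basis_exists[of V] dimV by metis
  have finC: "finite C" using C(4) k by (intro card_ge_0_finite) simp
  then obtain e where e: "bij_betw e {..<k} C"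
    using ex_bij_betw_nat_finite[of C] C(4) by (auto simp: atLeast0LessThan)
  then have eV: "e i \<in> V" if "i < k" for i
    using C(1) that by (auto simp: bij_betw_def)
  define M where "M = mat k (?q + 2)
    (\<lambda>(i, j). if j < ?q then eval_polfun (e i) (?en j) else if j = ?q then \<phi> (e i) else \<psi> (e i))"
  have M: "M \<in> carrier_mat k (?q + 2)" by (simp add: M_def)
  then have "has_row_comb_with_zeros k M"
    using zeros by (simp add: row_zeros_stmt_def)
  then obtain c i0 where c: "i0 < k" "c i0 \<noteq> 0"
      and card: "k \<le> card {j. j < ?q + 2 \<and> (\<Sum>i<k. c i * M $$ (i, j)) = 0}" (is "k \<le> card ?Z")
    unfolding has_row_comb_with_zeros_iff[OF M] by blast
  define v where "v = (\<Sum>i<k. scale_polfun (c i) (e i))"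
  have "v \<in> V"
    unfolding v_def V_def
    by (intro polfun.span_sum polfun.span_scale) (use eV in \<open>auto simp: V_def\<close>)
  have "v \<noteq> 0"
  proof
    assume "v = 0"
    \<comment> \<open>Independence of \<open>C\<close> concerns coefficients indexed by basis
      vectors, so \<open>c\<close> is carried over along the enumeration \<open>e\<close>.\<close>
    let ?u = "\<lambda>b. c (the_inv_into {..<k} e b)"
    have inv: "the_inv_into {..<k} e (e i) = i" if "i < k" for i
      using e that by (simp add: bij_betw_def the_inv_into_f_f)
    have "(\<Sum>b\<in>C. scale_polfun (?u b) b) = (\<Sum>i<k. scale_polfun (?u (e i)) (e i))"
      by (rule sum.reindex_bij_betw[OF e, symmetric])
    also have "\<dots> = v" by (simp add: v_def inv)
    finally have "?u (e i0) = 0"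
      using \<open>v = 0\<close> polfun.independentD[OF C(2) finC order_refl, of ?u "e i0"] e c(1)
      by (auto simp: bij_betw_def)
    then show False using c inv by simp
  qed
  define \<rho> where "\<rho> = card {a. eval_polfun v a = 0}"
  let ?A = "{j. j < ?q \<and> eval_polfun v (?en j) = 0}"
  have vals: "(\<Sum>i<k. c i * M $$ (i, j)) =
      (if j < ?q then eval_polfun v (?en j) else if j = ?q then \<phi> v else \<psi> v)" if "j < ?q + 2" for j
    using that \<phi>(1) \<psi>(1) eV by (simp add: M_def v_def eval_polfun_sum)
  have "?Z \<subseteq> ?A \<union> ((if \<phi> v = 0 then {?q} else {}) \<union> (if \<psi> v = 0 then {?q + 1} else {}))"
    using vals by (auto split: if_splits)
  then have "card ?Z \<le> card (?A \<union> ((if \<phi> v = 0 then {?q} else {}) \<union> (if \<psi> v = 0 then {?q + 1} else {})))"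
    by (rule card_mono[rotated]) simp
  also have "\<dots> \<le> card ?A + card ((if \<phi> v = 0 then {?q} else {}) \<union> (if \<psi> v = 0 then {?q + 1} else {}))"
    by (rule card_Un_le)
  also have "card ?A = \<rho>"
    unfolding \<rho>_def by (rule card_field_enumeration)
  also have "card ((if \<phi> v = 0 then {?q} else {}) \<union> (if \<psi> v = 0 then {?q + 1} else {})) =
      (if \<phi> v = 0 then 1 else 0) + (if \<psi> v = 0 then 1 else 0)"
    by auto
  finally have "k \<le> \<rho> + ((if \<phi> v = 0 then 1 else 0) + (if \<psi> v = 0 then 1 else 0))"
    using card by simp
  moreover have "int \<rho> \<le> n" if "v \<in> few_roots n" for n
    using that \<open>v \<noteq> 0\<close> by (simp add: few_roots_def \<rho>_def)
  then have "int \<rho> \<le> int k - 1" "\<phi> v = 0 \<or> \<psi> v = 0 \<Longrightarrow> int \<rho> \<le> int k - 2"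
    "\<phi> v = 0 \<and> \<psi> v = 0 \<Longrightarrow> int \<rho> \<le> int k - 3"
    using \<open>v \<in> V\<close> rootsV roots \<phi>(2) \<psi>(2) by blast+
  ultimately show False
    by (auto split: if_splits)
qed

subsection \<open>Extending Reed-Solomon codes\<close>

text \<open>The last \<open>k\<close> Reed-Solomon columns followed by b_1, ..., b_m form a basis.
  Its first \<open>k\<close> dual coordinates vanish on the b_i and so are coordinates on the
  quotient by their span. A combination with \<open>k\<close> zeros there lifts to a functional
  vanishing on a block excluded by (a).\<close>

lemma rs_extension_if_row_zeros:
  assumes zeros: "row_zeros_stmt TYPE('a :: {field,finite}) k"
  shows "rs_extension_stmt TYPE('a) k"
  unfolding rs_extension_stmt_def
proof (rule notI, elim exE conjE)
  let ?q = "CARD('a)"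
  fix s and bs :: "'a vec list"
  assume s: "k < s" "s \<le> ?q" and bs: "length bs = s - k + 2"
    and det: "\<forall>J. {?q..<?q + (s - k)} \<subseteq> J \<and> J \<subseteq> {..<?q + (s - k + 2)} \<and> card J = s \<longrightarrow>
      det (submatrix (mat_of_cols s (cols (reed_solomon s) @ bs)) UNIV J) \<noteq> 0"
  define m where "m = s - k"
  define E where "E = mat_of_cols s (cols (reed_solomon s) @ bs)"
  have E: "E \<in> carrier_mat s (?q + (m + 2))"
    unfolding E_def by (rule carrier_matI) (simp_all add: bs m_def reed_solomon_def)
  have no_comb: False if "{?q..<?q + m} \<subseteq> J" "J \<subseteq> {..<?q + (m + 2)}" "card J = s"
    "i < s" "c i \<noteq> 0" "\<forall>j\<in>J. (\<Sum>r<s. c r * E $$ (r, j)) = 0" for J i c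
  proof -
    have "det (submatrix E UNIV J) = 0"
      unfolding det_submatrix_eq_0_iff_rows[OF E that(2,3)] using that(4-6) by blast
    then show False
      using det[rule_format, of J] that(1-3) unfolding E_def m_def by simp
  qed
  \<comment> \<open>Starting at q - \<open>k\<close>, these \<open>s\<close> consecutive columns are
    \<open>k\<close> Reed-Solomon columns and then the \<open>m\<close> columns divided out, hence a
    block covered by (a).\<close>
  define B where "B = mat s s (\<lambda>(r, t). E $$ (r, ?q - k + t))"
  have B: "B \<in> carrier_mat s s" by (simp add: B_def)
  have B_index: "B $$ (r, t) = E $$ (r, ?q - k + t)" if "r < s" "t < s" for r t
    using that by (simp add: B_def)
  have det_B: "det B \<noteq> 0"
  proof
    assume "det B = 0"
    then obtain c i where c: "i < s" "c i \<noteq> 0" "\<forall>t<s. (\<Sum>r<s. c r * B $$ (r, t)) = 0"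
      unfolding det_eq_0_iff_rows[OF B] by blast
    show False
    proof (rule no_comb[of "{?q - k..<?q + m}" i c])
      show "\<forall>j\<in>{?q - k..<?q + m}. (\<Sum>r<s. c r * E $$ (r, j)) = 0"
      proof
        fix j assume j: "j \<in> {?q - k..<?q + m}"
        define t where "t = j - (?q - k)"
        have t: "t < s" "j = ?q - k + t"
          using j s by (auto simp: t_def m_def)
        show "(\<Sum>r<s. c r * E $$ (r, j)) = 0"
          using c(3) t by (simp add: B_index)
      qed
    qed (use c s in \<open>auto simp: m_def\<close>)
  qed
  obtain G where GB: "\<forall>i<s. \<forall>t<s. (\<Sum>r<s. G i r * B $$ (r, t)) = (if i = t then 1 else 0)"
    by (rule inverse_functions[OF B det_B]) (rule that)
  \<comment> \<open>The columns of the quotient code are those of \<open>E\<close> with the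
    \<open>m\<close> columns after the Reed-Solomon part skipped.\<close>
  define f where "f j = (if j < ?q then j else j + m)" for j
  define M where "M = mat k (?q + 2) (\<lambda>(i, j). \<Sum>r<s. G i r * E $$ (r, f j))"
  have M: "M \<in> carrier_mat k (?q + 2)" by (simp add: M_def)
  then have "has_row_comb_with_zeros k M"
    using zeros by (simp add: row_zeros_stmt_def)
  then obtain u i0 where u: "i0 < k" "u i0 \<noteq> 0"
      "k \<le> card {j. j < ?q + 2 \<and> (\<Sum>i<k. u i * M $$ (i, j)) = 0}"
    unfolding has_row_comb_with_zeros_iff[OF M] by blast
  obtain K where K: "K \<subseteq> {j. j < ?q + 2 \<and> (\<Sum>i<k. u i * M $$ (i, j)) = 0}" "card K = k"
    by (rule obtain_subset_with_card_n[OF u(3)])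
  have finK: "finite K" by (rule finite_subset[OF K(1)]) simp
  define c where "c r = (\<Sum>i<k. u i * G i r)" for r
  have comb: "(\<Sum>r<s. c r * E $$ (r, j)) = (\<Sum>i<k. u i * (\<Sum>r<s. G i r * E $$ (r, j)))" for j
  proof -
    have "(\<Sum>r<s. c r * E $$ (r, j)) = (\<Sum>r<s. \<Sum>i<k. u i * (G i r * E $$ (r, j)))"
      by (simp add: c_def sum_distrib_right mult.assoc)
    also have "\<dots> = (\<Sum>i<k. \<Sum>r<s. u i * (G i r * E $$ (r, j)))" by (rule sum.swap)
    finally show ?thesis by (simp add: sum_distrib_left)
  qed
  \<comment> \<open>On the basis \<open>B\<close> the lifted functional takes the values
    \<open>u\<close> and then zeros: it is nonzero and annihilates b_1, ..., b_m.\<close>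
  have unit: "(\<Sum>r<s. c r * E $$ (r, ?q - k + t)) = (if t < k then u t else 0)" if "t < s" for t
  proof -
    have "(\<Sum>i<k. u i * (\<Sum>r<s. G i r * E $$ (r, ?q - k + t))) = (\<Sum>i<k. if i = t then u i else 0)"
      using GB that s by (intro sum.cong) (auto simp: B_index)
    then show ?thesis by (simp add: comb)
  qed
  have "\<exists>r<s. c r \<noteq> 0"
  proof (rule ccontr)
    assume "\<not> (\<exists>r<s. c r \<noteq> 0)"
    then show False using unit[of i0] u(1,2) s by simp
  qed
  then obtain r where r: "r < s" "c r \<noteq> 0" by blast
  show False
  proof (rule no_comb[of _ r c, OF _ _ _ r])
    have "inj_on f K" by (auto simp: f_def inj_on_def split: if_splits)
    then have "card (f ` K) = k" using K(2) by (simp add: card_image)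
    moreover have "{?q..<?q + m} \<inter> f ` K = {}" by (auto simp: f_def)
    ultimately show "card ({?q..<?q + m} \<union> f ` K) = s"
      using finK s by (subst card_Un_disjoint) (auto simp: m_def)
    show "{?q..<?q + m} \<union> f ` K \<subseteq> {..<?q + (m + 2)}"
      using K(1) by (auto simp: f_def)
    show "\<forall>j\<in>{?q..<?q + m} \<union> f ` K. (\<Sum>r<s. c r * E $$ (r, j)) = 0"
    proof
      fix j assume "j \<in> {?q..<?q + m} \<union> f ` K"
      then consider "?q \<le> j" "j < ?q + m" | l where "l \<in> K" "j = f l" by auto
      then show "(\<Sum>r<s. c r * E $$ (r, j)) = 0"
      proof cases
        case 1
        define t where "t = j - (?q - k)"
        have t: "t < s" "\<not> t < k" "j = ?q - k + t"
          using 1 s by (auto simp: t_def m_def)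
        show ?thesis using unit[OF t(1)] t(2,3) by simp
      next
        case 2
        then have "l < ?q + 2" "(\<Sum>i<k. u i * M $$ (i, l)) = 0" using K(1) by auto
        then show ?thesis by (simp add: comb M_def 2(2))
      qed
    qed
  qed auto
qed

lemma row_zeros_if_rs_extension:
  assumes k: "2 \<le> k" "k \<le> CARD('a :: {field,finite})" and rs: "rs_extension_stmt TYPE('a) k"
  shows "row_zeros_stmt TYPE('a) k"
proof (rule ccontr)
  let ?q = "CARD('a)"
  assume "\<not> row_zeros_stmt TYPE('a) k"
  then obtain M :: "'a mat" where M: "M \<in> carrier_mat k (?q + 2)" "\<not> has_row_comb_with_zeros k M"
    unfolding row_zeros_stmt_def by blast
  \<comment> \<open>Excluding both extremes gives \<open>k\<close> < q, so that s = q is admissible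
    in (5), and \<open>k\<close> at least 3, as the rescaling argument requires.\<close>
  have "k \<noteq> 2"
    using M has_row_comb_with_zeros_dim_2[of M] by auto
  moreover have "k \<noteq> ?q"
    using M has_row_comb_with_zeros_dim_CARD[of M] by auto
  ultimately have k': "3 \<le> k" "k < ?q" using k by simp_all
  define m where "m = ?q - k"
  have m: "k + m = ?q" using k' by (simp add: m_def)
  define R where "R = (reed_solomon ?q :: 'a mat)"
  have R: "R \<in> carrier_mat ?q ?q" by (simp add: R_def reed_solomon_def)
  have det_R: "det R \<noteq> 0" by (simp add: R_def det_reed_solomon)
  obtain G where
    GR: "\<forall>i<?q. \<forall>j<?q. (\<Sum>t<?q. G i t * R $$ (t, j)) = (if i = j then 1 else 0)" and
    RG: "\<forall>i<?q. \<forall>j<?q. (\<Sum>t<?q. R $$ (i, t) * G t j) = (if i = j then 1 else 0)"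
    by (rule inverse_functions[OF R det_R])
  \<comment> \<open>The last column of the inverse of \<open>R\<close>: the coordinates of the last
    unit vector in terms of the Reed-Solomon columns.\<close>
  define w where "w a = G a (?q - 1)" for a
  have Rw: "(\<Sum>a<?q. R $$ (r, a) * w a) = (if r = ?q - 1 then 1 else 0)" if "r < ?q" for r
    using RG that by (simp add: w_def)
  have "\<exists>a<?q. w a \<noteq> 0"
  proof (rule ccontr)
    assume "\<not> (\<exists>a<?q. w a \<noteq> 0)"
    then show False using Rw[of "?q - 1"] k' by simp
  qed
  then obtain a0 where a0: "a0 < ?q" "w a0 \<noteq> 0" by blast
  have "\<not> UNIV \<subseteq> {0, 1 :: 'a}"
    using card_mono[of "{0, 1 :: 'a}" UNIV] k' by auto
  then obtain l :: 'a where l: "l \<noteq> 0" "l \<noteq> 1" by blast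
  have kq: "k \<le> ?q + 2" using k' by simp
  \<comment> \<open>Prepares condition (b): no nontrivial relation of the code starts with a
    multiple of \<open>w\<close>. Normalization comes afterwards and preserves this by
    \<open>N1N\<close>.\<close>
  obtain N1 :: "'a mat" where N1: "N1 \<in> carrier_mat k (?q + 2)" "\<not> has_row_comb_with_zeros k N1"
    and free1: "\<forall>x b. (\<forall>i<k. (\<Sum>j<?q + 2. N1 $$ (i, j) * x j) = 0) \<longrightarrow>
      (\<forall>j<?q. x j = b * w j) \<longrightarrow> (\<forall>j<?q + 2. x j = 0)"
    by (rule mds_avoiding_relations[where w = w and a = a0, OF M k'(1) kq a0 l])
  obtain N :: "'a mat" where N: "N \<in> carrier_mat k (?q + 2)" and mds: "\<not> has_row_comb_with_zeros k N"
    and unit: "\<forall>i<k. \<forall>j<k. N $$ (i, j) = (if i = j then 1 else 0)"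
    and N1N: "\<forall>x. (\<forall>i<k. (\<Sum>j<?q + 2. N $$ (i, j) * x j) = 0) \<longrightarrow>
      (\<forall>i<k. (\<Sum>j<?q + 2. N1 $$ (i, j) * x j) = 0)"
    by (rule normalize_rows[OF N1(1) kq N1(2)])
  \<comment> \<open>Column \<open>i\<close> of [-A c d; I 0 0], where [I A c d] is \<open>N\<close>.
    For \<open>i\<close> equal to \<open>m\<close> or \<open>m + 1\<close> the index
    \<open>k + i\<close> is at least q, so the lower part is zero.\<close>
  define X where "X i a = (if a < k then (if i < m then - N $$ (a, k + i) else N $$ (a, k + i))
    else if a = k + i then 1 else 0)" for i a
  have X_sum: "(\<Sum>a<?q. f a * X i a) = (if i < m then f (k + i) - (\<Sum>a<k. f a * N $$ (a, k + i))
      else (\<Sum>a<k. f a * N $$ (a, k + i)))" for f i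
  proof -
    have "(\<Sum>a<?q. f a * X i a) =
        (\<Sum>a<?q. if a < k then f a * X i a else 0) + (\<Sum>a<?q. if a = k + i then f a else 0)"
      unfolding sum.distrib[symmetric] by (intro sum.cong) (auto simp: X_def)
    also have "(\<Sum>a<?q. if a < k then f a * X i a else 0) = (\<Sum>a<k. f a * X i a)"
      using k' by (intro sum.mono_neutral_cong_right) auto
    also have "\<dots> = (if i < m then - (\<Sum>a<k. f a * N $$ (a, k + i)) else (\<Sum>a<k. f a * N $$ (a, k + i)))"
      by (simp add: X_def sum_negf)
    also have "(\<Sum>a<?q. if a = k + i then f a else 0) = (if i < m then f (k + i) else 0)"
      using m by auto
    finally show ?thesis by simp
  qed
  define bs where "bs = map (\<lambda>i. vec ?q (\<lambda>r. \<Sum>a<?q. R $$ (r, a) * X i a)) [0..<m + 2]"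
  have len: "length bs = m + 2" by (simp add: bs_def)
  have bs: "set bs \<subseteq> carrier_vec ?q" by (auto simp: bs_def)
  have bs_nth: "(bs ! i) $ r = (\<Sum>a<?q. R $$ (r, a) * X i a)" if "i < m + 2" "r < ?q" for i r
    using that by (simp add: bs_def del: upt_Suc)
  define E where "E = mat_of_cols ?q (cols R @ bs)"
  have E: "E \<in> carrier_mat ?q (?q + (m + 2))"
    unfolding E_def by (rule carrier_matI) (use R len in simp_all)
  have E_index: "E $$ (r, j) = (if j < ?q then R $$ (r, j) else \<Sum>a<?q. R $$ (r, a) * X (j - ?q) a)"
    if "r < ?q" "j < ?q + (m + 2)" for r j
    using that R len by (auto simp: E_def mat_of_cols_index nth_append bs_nth)
  have "det (submatrix E UNIV J) \<noteq> 0"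
    if J: "{?q..<?q + m} \<subseteq> J" "J \<subseteq> {..<?q + (m + 2)}" "card J = ?q" for J
  proof
    assume "det (submatrix E UNIV J) = 0"
    then obtain c i where c: "i < ?q" "c i \<noteq> 0" "\<forall>j\<in>J. (\<Sum>r<?q. c r * E $$ (r, j)) = 0"
      unfolding det_submatrix_eq_0_iff_rows[OF E J(2,3)] by blast
    \<comment> \<open>The values of the functional \<open>c\<close> on the Reed-Solomon columns, not
      all zero since \<open>R\<close> is invertible.\<close>
    define y where "y a = (\<Sum>r<?q. c r * R $$ (r, a))" for a
    have "\<exists>a<?q. y a \<noteq> 0"
      using det_R c(1,2) unfolding det_eq_0_iff_rows[OF R] y_def by blast
    then obtain a1 where a1: "a1 < ?q" "y a1 \<noteq> 0" by blast
    have y0: "y j = 0" if "j \<in> J" "j < ?q" for j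
      using c(3)[rule_format, OF that(1)] that(2) by (simp add: y_def E_index)
    have yX: "(\<Sum>a<?q. y a * X i a) = 0" if "?q + i \<in> J" for i
    proof -
      have "i < m + 2" using J(2) that by auto
      have "(\<Sum>a<?q. y a * X i a) = (\<Sum>a<?q. \<Sum>r<?q. c r * (R $$ (r, a) * X i a))"
        by (simp add: y_def sum_distrib_right mult.assoc)
      also have "\<dots> = (\<Sum>r<?q. \<Sum>a<?q. c r * (R $$ (r, a) * X i a))" by (rule sum.swap)
      also have "\<dots> = (\<Sum>r<?q. c r * E $$ (r, ?q + i))"
        using \<open>i < m + 2\<close> by (simp add: E_index sum_distrib_left)
      finally show ?thesis using c(3) that by simp
    qed
    \<comment> \<open>Vanishing on the columns of [-A; I] means that \<open>y\<close> is the first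
      \<open>k\<close> of its entries times [I A]. So zeros of \<open>y\<close> are zeros of a
      combination of the rows of \<open>N\<close>.\<close>
    have y_comb: "(\<Sum>a<k. y a * N $$ (a, j)) = y j" if "j < ?q" for j
    proof (cases "j < k")
      case True
      then show ?thesis by (rule identity_block_comb[OF unit])
    next
      case False
      define i where "i = j - k"
      have i: "i < m" "j = k + i" using False that m by (auto simp: i_def)
      then have "?q + i \<in> J" using J(1) by auto
      then show ?thesis using yX[of i] X_sum[of y i] i by simp
    qed
    have "\<exists>a<k. y a \<noteq> 0"
    proof (rule ccontr)
      assume "\<not> (\<exists>a<k. y a \<noteq> 0)"
      then show False using y_comb[OF a1(1)] a1(2) by simp
    qed
    then obtain a2 where a2: "a2 < k" "y a2 \<noteq> 0" by blast
    \<comment> \<open>Matches the columns of \<open>E\<close> outside b_1, ..., b_m with the columns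
      of \<open>N\<close>; the last two shift down by \<open>m\<close>.\<close>
    define f where "f j = (if j < ?q then j else j - m)" for j
    define K where "K = J - {?q..<?q + m}"
    have K: "j < ?q \<or> ?q + m \<le> j" "j < ?q + (m + 2)" "j \<in> J" if "j \<in> K" for j
      using that J(2) by (auto simp: K_def)
    have "inj_on f K"
    proof (rule inj_onI)
      fix i j assume "i \<in> K" "j \<in> K" "f i = f j"
      then show "i = j"
        using K(1)[of i] K(1)[of j] by (auto simp: f_def split: if_splits)
    qed
    then have "card (f ` K) = card K" by (rule card_image)
    also have "card K = k"
      using J m by (simp add: K_def card_Diff_subset)
    finally have card: "k \<le> card (f ` K)" by simp
    have "has_row_comb_with_zeros k N"
    proof (rule has_row_comb_with_zerosI[OF N, of a2 y, OF a2 _ card])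
      show "f ` K \<subseteq> {..<?q + 2}"
      proof
        fix j assume "j \<in> f ` K"
        then obtain t where "t \<in> K" "j = f t" by blast
        then show "j \<in> {..<?q + 2}" using K(2)[of t] by (auto simp: f_def)
      qed
      fix j assume "j \<in> f ` K"
      then obtain t where t: "t \<in> K" "j = f t" by blast
      show "(\<Sum>i<k. y i * N $$ (i, j)) = 0"
      proof (cases "t < ?q")
        case True
        then show ?thesis using y_comb[OF True] y0[OF K(3)[OF t(1)] True] t(2) by (simp add: f_def)
      next
        case False
        define i where "i = t - ?q"
        have i: "t = ?q + i" "\<not> i < m" "j = k + i"
          using K(1)[OF t(1)] False t(2) m by (auto simp: i_def f_def)
        then show ?thesis using yX[of i] X_sum[of y i] K(3)[OF t(1)] by simp
      qed
    qed
    then show False using mds by simp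
  qed
  moreover have "lin_indpt_list ?q (bs @ [unit_vec ?q (?q - 1)])"
  proof (rule lin_indpt_listI)
    fix c i
    assume rel: "\<And>r. r < ?q \<Longrightarrow>
        (\<Sum>i<length (bs @ [unit_vec ?q (?q - 1)]). c i * ((bs @ [unit_vec ?q (?q - 1)]) ! i) $ r) = 0"
      and i: "i < length (bs @ [unit_vec ?q (?q - 1)])"
    \<comment> \<open>The given relation written in coordinates with respect to the columns of
      \<open>R\<close>, with \<open>w\<close> standing for the last unit vector.\<close>
    define z where "z a = (\<Sum>i<m + 2. c i * X i a) + c (m + 2) * w a" for a
    have "(\<Sum>a<?q. R $$ (r, a) * z a) = 0" if r: "r < ?q" for r
    proof -
      have "(\<Sum>a<?q. R $$ (r, a) * z a) =
          (\<Sum>a<?q. \<Sum>i<m + 2. c i * (R $$ (r, a) * X i a)) + c (m + 2) * (\<Sum>a<?q. R $$ (r, a) * w a)"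
        unfolding sum_distrib_left sum.distrib[symmetric]
        by (intro sum.cong refl) (simp only: z_def distrib_left sum_distrib_left mult_ac)
      also have "(\<Sum>a<?q. \<Sum>i<m + 2. c i * (R $$ (r, a) * X i a)) = (\<Sum>i<m + 2. c i * (bs ! i) $ r)"
        using r by (subst sum.swap, intro sum.cong refl) (simp add: bs_nth sum_distrib_left)
      also have "\<dots> + c (m + 2) * (\<Sum>a<?q. R $$ (r, a) * w a) =
          (\<Sum>i<length (bs @ [unit_vec ?q (?q - 1)]). c i * ((bs @ [unit_vec ?q (?q - 1)]) ! i) $ r)"
        using r by (simp add: len nth_append Rw)
      finally show ?thesis using rel[OF r] by simp
    qed
    then have z0: "z a = 0" if "a < ?q" for a
      using det_R that unfolding det_eq_0_iff_cols[OF R] by blast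
    \<comment> \<open>Applying [I A] to \<open>z\<close> = 0 removes the columns [-A; I] and sends
      the other two to \<open>c\<close> and \<open>d\<close>. What remains is this relation between
      the columns of \<open>N\<close>, of the kind excluded by \<open>free1\<close>.\<close>
    define x where "x j = (if j < ?q then c (m + 2) * w j else if j = ?q then c m else c (m + 1))" for j
    have "(\<Sum>j<?q + 2. N $$ (r, j) * x j) = 0" if r: "r < k" for r
    proof -
      have NX: "(\<Sum>a<?q. N $$ (r, a) * X i a) = (if i < m then 0 else N $$ (r, k + i))" for i
      proof -
        have "(\<Sum>a<k. N $$ (r, a) * N $$ (a, k + i)) = (\<Sum>a<k. if a = r then N $$ (a, k + i) else 0)"
          using unit r by (intro sum.cong) auto
        then show ?thesis using r by (simp add: X_sum)
      qed
      have "0 = (\<Sum>a<?q. N $$ (r, a) * z a)" by (simp add: z0)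
      also have "\<dots> = (\<Sum>a<?q. \<Sum>i<m + 2. c i * (N $$ (r, a) * X i a)) +
          c (m + 2) * (\<Sum>a<?q. N $$ (r, a) * w a)"
        unfolding sum_distrib_left sum.distrib[symmetric]
        by (intro sum.cong refl) (simp only: z_def distrib_left sum_distrib_left mult_ac)
      also have "(\<Sum>a<?q. \<Sum>i<m + 2. c i * (N $$ (r, a) * X i a)) =
          (\<Sum>i<m + 2. c i * (if i < m then 0 else N $$ (r, k + i)))"
        unfolding NX[symmetric] sum_distrib_left by (rule sum.swap)
      also have "\<dots> = c m * N $$ (r, ?q) + c (m + 1) * N $$ (r, ?q + 1)"
        using m by simp
      also have "\<dots> + c (m + 2) * (\<Sum>a<?q. N $$ (r, a) * w a) = (\<Sum>j<?q + 2. N $$ (r, j) * x j)"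
        by (simp add: x_def sum_distrib_left mult_ac)
      finally show ?thesis by simp
    qed
    then have "\<forall>i<k. (\<Sum>j<?q + 2. N1 $$ (i, j) * x j) = 0"
      using N1N by blast
    moreover have "\<forall>j<?q. x j = c (m + 2) * w j" by (simp add: x_def)
    ultimately have x0: "\<forall>j<?q + 2. x j = 0" using free1 by blast
    \<comment> \<open>The entry at \<open>a0\<close>, where \<open>w\<close> is nonzero, gives the
      third equation.\<close>
    have last: "c m = 0" "c (m + 1) = 0" "c (m + 2) = 0"
      using x0[rule_format, of ?q] x0[rule_format, of "?q + 1"] x0[rule_format, of a0] a0
      by (simp_all add: x_def)
    \<comment> \<open>The identity block below -A isolates each remaining coefficient.\<close>
    have "c i = 0" if "i < m" for i
    proof -
      have "z (k + i) = (\<Sum>t<m + 2. if t = i then c t else 0)"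
        unfolding z_def last mult_zero_left add_0_right by (intro sum.cong) (auto simp: X_def)
      then show ?thesis using z0[of "k + i"] that m by simp
    qed
    moreover have "i < m \<or> i = m \<or> i = m + 1 \<or> i = m + 2"
      using i len by auto
    ultimately show "c i = 0" using last by auto
  qed (use bs in auto)
  moreover have "\<not> ((\<forall>J. {?q..<?q + (?q - k)} \<subseteq> J \<and> J \<subseteq> {..<?q + (?q - k + 2)} \<and> card J = ?q \<longrightarrow>
        det (submatrix (mat_of_cols ?q (cols (reed_solomon ?q) @ bs)) UNIV J) \<noteq> 0) \<and>
      lin_indpt_list ?q (bs @ [unit_vec ?q (?q - 1)]))"
    using rs[unfolded rs_extension_stmt_def not_ex, rule_format, of ?q bs] len bs k'(2)
    unfolding m_def by simp
  ultimately show False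
    unfolding E_def R_def m_def by simp
qed

theorem theorem1p4:
  fixes p r q k :: nat
  assumes "prime p" and "r > 0" and "q = p ^ r"
    and "CARD('a :: {field,finite}) = q"
    and "2 \<le> k" and "k \<le> q"
    and "odd q \<or> (even q \<and> k \<notin> {3, q - 1})"
  shows
    "((mds_width_stmt TYPE('a) k \<longleftrightarrow> row_zeros_stmt TYPE('a) k) \<and>
      (row_zeros_stmt TYPE('a) k \<longleftrightarrow> row_zeros_normalized_stmt TYPE('a) k) \<and>
      (row_zeros_normalized_stmt TYPE('a) k \<longleftrightarrow> rs_extension_stmt TYPE('a) k)) \<and>
     (row_zeros_normalized_stmt TYPE('a) k \<longrightarrow> subspaces_stmt TYPE('a) k)"
proof -
  have k: "0 < k" "2 \<le> k" "k \<le> CARD('a)" "k \<le> CARD('a) + 2"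
    and exc: "\<not> (even CARD('a) \<and> k \<in> {3, CARD('a) - 1})"
    using assms by auto
  show ?thesis
    unfolding row_zeros_normalized_iff[OF k(2,4)]
    using mds_width_iff_row_zeros[OF k(1,3) exc] rs_extension_if_row_zeros
      row_zeros_if_rs_extension[OF k(2,3)] subspaces_if_row_zeros[OF _ k(1)]
    by blast
qed

end
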